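(* Let $a\ge2$ be an integer, $H=\langle a,a+1\rangle$, $k$ a field, $A=k[[H]]=k[[t^a,t^{a+1}]]\subseteq k[[t]]$, and $\mathfrak m=(t^a,t^{a+1})$ the maximal ideal of $A$. Let $q=a-1$, let $s\in H$ with $0<s<aq$, and put $Q=(t^s)$ and $I=Q:\mathfrak m^q$. Write $s=a\ell+r$ with integers $1\le\ell<q$ and $0\le r<a$. Then the following assertions hold. (1) If $r=0$, then $I=\mathfrak m^\ell$ and $\mathrm G(I)$ is a Cohen-Macaulay ring. (2) If $r=\ell$, then $\mathrm G(I)$ is a Cohen-Macaulay ring with $\mathrm r_Q(I)=\left\lceil\frac{a-1}{\ell+1}\right\rceil$.
   Context: $\langle a,a+1\rangle=\{\alpha a+\beta(a+1)\mid 0\le\alpha,\beta\in\mathbb Z\}$. $k[[t]]$ is the formal power series ring in an indeterminate $t$; $Q:\mathfrak m^q=\{x\in A\mid\mathfrak m^qx\subseteq Q\}$. $\mathrm G(I)=\bigoplus_{n\ge0}I^n/I^{n+1}$ is the associated graded ring, and $\mathrm r_Q(I)=\min\{0\le n\in\mathbb Z\mid I^{n+1}=QI^n\}$ is the reduction number of $I$ with respect to $Q$. Under the stated hypotheses one always has $r\le\ell$ (because $s\in H$). *)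

theory Defs
  imports
    "HOL-Algebra.Algebra"
    "HOL-Algebra.Algebraic_Closure_Type"
    "HOL-Computational_Algebra.Formal_Power_Series"
    "HOL-Library.Extended_Nat"
begin

section \<open>Ideals, reduction numbers and associated graded rings\<close>

abbreviation ideal_pow :: "('a, 'b) ring_scheme \<Rightarrow> 'a set \<Rightarrow> nat \<Rightarrow> 'a set"
  where "ideal_pow R I n \<equiv> I [^]\<^bsub>ideals_set R\<^esub> n"

definition ideal_colon :: "('a, 'b) ring_scheme \<Rightarrow> 'a set \<Rightarrow> 'a set \<Rightarrow> 'a set"
  where "ideal_colon R Q J = {x \<in> carrier R. \<forall>y\<in>J. x \<otimes>\<^bsub>R\<^esub> y \<in> Q}"

text \<open>The value is \<open>\<infinity>\<close> if \<open>Q\<close> is not a reduction of \<open>I\<close>, that is, if no such \<open>n\<close> exists.\<close>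

definition reduction_number :: "('a, 'b) ring_scheme \<Rightarrow> 'a set \<Rightarrow> 'a set \<Rightarrow> enat"
  where "reduction_number R Q I =
    Inf {enat n | n. ideal_pow R I (Suc n) = Q \<cdot>\<^bsub>R\<^esub> ideal_pow R I n}"

text \<open>
  An element of the direct sum of the \<open>I\<^sup>n/I\<^sup>n\<^sup>+\<^sup>1\<close> is a family \<open>f\<close> whose member \<open>f n\<close> is a
  coset of \<open>I\<^sup>n\<^sup>+\<^sup>1\<close> contained in \<open>I\<^sup>n\<close>, and is the zero coset \<open>I\<^sup>n\<^sup>+\<^sup>1\<close> itself for almost all \<open>n\<close>.
  For \<open>x \<in> I\<^sup>i\<close> and \<open>y \<in> I\<^sup>j\<close> with \<open>i + j = n\<close>, the product of the classes of \<open>x\<close> in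
  \<open>I\<^sup>i/I\<^sup>i\<^sup>+\<^sup>1\<close> and of \<open>y\<close> in \<open>I\<^sup>j/I\<^sup>j\<^sup>+\<^sup>1\<close> is the class of \<open>x y\<close> modulo \<open>I\<^sup>n\<^sup>+\<^sup>1\<close>; as \<^const>\<open>rcoset_mult\<close>
  multiplies representatives and then passes to cosets of its modulus, it computes this product
  although its two arguments are cosets of different ideals.
\<close>

definition assoc_graded :: "('a, 'b) ring_scheme \<Rightarrow> 'a set \<Rightarrow> (nat \<Rightarrow> 'a set) ring"
  where "assoc_graded R I =
    \<lparr>carrier = {f. (\<forall>n. \<exists>x \<in> ideal_pow R I n. f n = ideal_pow R I (Suc n) +>\<^bsub>R\<^esub> x) \<and>
                   finite {n. f n \<noteq> ideal_pow R I (Suc n)}},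
     monoid.mult = (\<lambda>f g n. finsum (R Quot ideal_pow R I (Suc n))
                (\<lambda>i. rcoset_mult R (ideal_pow R I (Suc n)) (f i) (g (n - i))) {..n}),
     one = (\<lambda>n. if n = 0 then ideal_pow R I 1 +>\<^bsub>R\<^esub> \<one>\<^bsub>R\<^esub> else ideal_pow R I (Suc n)),
     ring.zero = (\<lambda>n. ideal_pow R I (Suc n)),
     add = (\<lambda>f g n. f n <+>\<^bsub>R\<^esub> g n)\<rparr>"


section \<open>Cohen-Macaulay rings\<close>

definition ideal_height :: "('a, 'b) ring_scheme \<Rightarrow> 'a set \<Rightarrow> enat"
  where "ideal_height R P =
    Sup {enat n | n. \<exists>c. (\<forall>i\<le>n. primeideal (c i) R) \<and> (\<forall>i<n. c i \<subset> c (Suc i)) \<and> c n = P}"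

text \<open>
  The second condition says that the entry \<open>xs ! i\<close> is a nonzerodivisor on the quotient of \<open>R\<close> by
  the ideal generated by the preceding entries.
\<close>

definition regular_sequence :: "('a, 'b) ring_scheme \<Rightarrow> 'a list \<Rightarrow> bool"
  where "regular_sequence R xs \<longleftrightarrow>
    set xs \<subseteq> carrier R \<and>
    (\<forall>i < length xs. \<forall>y \<in> carrier R.
       xs ! i \<otimes>\<^bsub>R\<^esub> y \<in> Idl\<^bsub>R\<^esub> (set (take i xs)) \<longrightarrow> y \<in> Idl\<^bsub>R\<^esub> (set (take i xs))) \<and>
    Idl\<^bsub>R\<^esub> (set xs) \<noteq> carrier R"

definition ideal_depth :: "('a, 'b) ring_scheme \<Rightarrow> 'a set \<Rightarrow> enat"
  where "ideal_depth R P = Sup {enat (length xs) | xs. regular_sequence R xs \<and> set xs \<subseteq> P}"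

text \<open>
  The definition of Eisenbud, Commutative Algebra, Section 18.2: a Noetherian ring in which depth
  and codimension (height) of every maximal ideal agree. Since these are the depth and the
  dimension of the localization at the maximal ideal, this says that all these localizations are
  Cohen-Macaulay local rings. All maximal ideals are meant, not only homogeneous ones.
\<close>

definition cohen_macaulay_ring :: "('a, 'b) ring_scheme \<Rightarrow> bool"
  where "cohen_macaulay_ring R \<longleftrightarrow>
    cring R \<and> noetherian_ring R \<and>
    (\<forall>M. maximalideal M R \<longrightarrow> ideal_depth R M = ideal_height R M)"


section \<open>Numerical semigroup rings\<close>

definition semigroup_gen2 :: "nat \<Rightarrow> nat \<Rightarrow> nat set"
  where "semigroup_gen2 a b = {\<alpha> * a + \<beta> * b | \<alpha> \<beta>. True}"

text \<open>The ring \<open>k[[H]]\<close> of all power series with exponents in \<open>H\<close>, as a subring of \<open>k[[t]]\<close>.\<close>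

definition semigroup_ring :: "nat set \<Rightarrow> 'k::field fps ring"
  where "semigroup_ring H =
    ring_of_type_algebra \<lparr>carrier := {f. \<forall>n. fps_nth f n \<noteq> 0 \<longrightarrow> n \<in> H}\<rparr>"

lemma cring_semigroup_ring:
  assumes "0 \<in> H" and add: "\<And>x y. x \<in> H \<Longrightarrow> y \<in> H \<Longrightarrow> x + y \<in> H"
  shows "cring (semigroup_ring H :: 'k::field fps ring)"
proof -
  have mult: "n \<in> H" if f: "\<forall>n. fps_nth f n \<noteq> 0 \<longrightarrow> n \<in> H"
    and g: "\<forall>n. fps_nth g n \<noteq> 0 \<longrightarrow> n \<in> H" and "fps_nth (f * g) n \<noteq> 0" for f g :: "'k fps" and n
  proof -
    from that(3) obtain i where "i \<in> {0..n}" "fps_nth f i * fps_nth g (n - i) \<noteq> 0"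
      unfolding fps_mult_nth by (meson sum.not_neutral_contains_not_neutral)
    with add[of i "n - i"] f g show ?thesis by auto
  qed
  let ?R = "semigroup_ring H :: 'k fps ring"
  note simps = semigroup_ring_def ring_of_type_algebra_def
  have sum: "n \<in> H" if "\<forall>n. fps_nth f n \<noteq> 0 \<longrightarrow> n \<in> H" "\<forall>n. fps_nth g n \<noteq> 0 \<longrightarrow> n \<in> H"
    "fps_nth f n + fps_nth g n \<noteq> 0" for f g :: "'k fps" and n
    using that by (metis add.left_neutral)
  have neg: "\<exists>y. (\<forall>n. fps_nth y n \<noteq> 0 \<longrightarrow> n \<in> H) \<and> x + y = 0"
    if "\<forall>n. fps_nth x n \<noteq> 0 \<longrightarrow> n \<in> H" for x :: "'k fps"
    using that by (intro exI[of _ "- x"]) auto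
  show ?thesis
  proof (rule cringI)
    show "abelian_group ?R"
      by (rule abelian_groupI) (auto simp: simps algebra_simps intro: sum dest: neg)
    show "Group.comm_monoid ?R"
      by (rule Group.comm_monoidI) (use assms in \<open>auto simp: simps algebra_simps intro: mult split: if_splits\<close>)
  qed (auto simp: simps algebra_simps)
qed

end

(*
  Put V = k[[t]] and c = a (a - 1). All ideals that occur are spanned by monomials: m^n consists of
  the series of order at least a n, and since t^c V is the conductor of A in V, the ideal I consists
  of the series in A of order at least s. So I^n is given by the set of n-fold sums of the exponents
  of I, and I^(n+1) = Q I^n becomes an equation between sets of numbers.

  In both cases these exponent sets show that multiplication by the class T of t^s in I/I^2 is
  injective on G(I). Hence G(I) is a finitely generated torsion-free module over k[T]. Moreover
  every monomial of G(I) that is not a power of T is nilpotent, so G(I) = k[T] + N with a nil ideal N.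
  The primes of G(I) are then those of k[T], whence every maximal ideal has height 1. It contains
  some p(T) \<noteq> 0, which is regular, and it contains no regular sequence of length 2: if x is a
  regular element of M, then p(T) is in (x) for some p \<noteq> 0, and a polynomial p of least degree
  with this property could be divided by a common factor with any y in M that is regular modulo x.
*)
theory Submission
  imports Defs "HOL-Computational_Algebra.Polynomial"
begin

section \<open>Nil extensions of a polynomial ring\<close>

text \<open>The Cohen-Macaulay condition ranges over all maximal ideals, so homogeneous elements
  alone do not suffice. This shapes the abstract part: for a retraction onto k[T] with nil kernel,
  an arbitrary element and its image in k[T] differ by a nilpotent, so they belong to the same
  primes and each divides a power of the other. The constant c is sharp: c - 1 has quotient a - 2
  and remainder a - 1 modulo a and is the largest number outside H. The same number determines I: a
  term t^h with h < s is moved to exponent s + c - 1, outside s + H, by a monomial of m^q.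
  Injectivity of T has two sources. For s = a l the powers of I are powers of m, described by one
  inequality. For s = (a + 1) l the number s is the last element of H with quotient at most l, so I
  = (t^s) + m^(l+1); cancelling t^s then works because s < a (l + 1). The reduction number comes
  from a single critical exponent of m^((l+1)(n+1)). A further obstacle is that products of ideals
  consist of finite sums, whereas monomial ideals contain infinite series; the conductor bridges
  this gap.\<close>

lemma poly_ideal_principal:
  fixes L :: "'k::field poly set"
  assumes "0 \<in> L" and diff: "\<And>p q. p \<in> L \<Longrightarrow> q \<in> L \<Longrightarrow> p - q \<in> L"
    and mult: "\<And>u p. p \<in> L \<Longrightarrow> u * p \<in> L"
  obtains g where "g \<in> L" "\<And>p. p \<in> L \<Longrightarrow> g dvd p"
proof (cases "L = {0}")
  case True
  with that show ?thesis by blast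
next
  case False
  with \<open>0 \<in> L\<close> obtain p where "p \<in> L" "p \<noteq> 0" by auto
  then obtain g where g: "g \<in> L" "g \<noteq> 0"
    and min: "\<And>p. p \<in> L \<Longrightarrow> p \<noteq> 0 \<Longrightarrow> Polynomial.degree g \<le> Polynomial.degree p"
    using ex_has_least_nat[of "\<lambda>p. p \<in> L \<and> p \<noteq> 0" p Polynomial.degree] by blast
  have "g dvd p" if "p \<in> L" for p
  proof -
    have "p mod g = p - (p div g) * g"
      by (simp add: minus_div_mult_eq_mod)
    then have "p mod g \<in> L"
      using diff mult g that by simp
    then have "p mod g = 0"
      using min[of "p mod g"] degree_mod_less'[of g p] g by fastforce
    then show ?thesis by auto
  qed
  with g that show ?thesis by blast
qed

text \<open>The k[T]-submodule generated by \<open>E\<close>, with scalars acting through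
  \<open>\<sigma>\<close>. Closure rules in place of linear combinations permit induction without
  finite sums; membership in the carrier is a separate fact.\<close>

inductive_set module_span :: "('a, 'b) ring_scheme \<Rightarrow> ('c \<Rightarrow> 'a) \<Rightarrow> 'a set \<Rightarrow> 'a set"
  for R (structure) and \<sigma> and E where
    zero: "\<zero> \<in> module_span R \<sigma> E"
  | incl: "e \<in> E \<Longrightarrow> e \<in> module_span R \<sigma> E"
  | add: "x \<in> module_span R \<sigma> E \<Longrightarrow> y \<in> module_span R \<sigma> E \<Longrightarrow> x \<oplus> y \<in> module_span R \<sigma> E"
  | scale: "x \<in> module_span R \<sigma> E \<Longrightarrow> \<sigma> p \<otimes> x \<in> module_span R \<sigma> E"

lemma module_span_mono:
  assumes "E \<subseteq> F"
  shows "module_span R \<sigma> E \<subseteq> module_span R \<sigma> F"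
proof
  fix x assume "x \<in> module_span R \<sigma> E"
  then show "x \<in> module_span R \<sigma> F"
    by induction (use assms in \<open>auto intro: module_span.intros\<close>)
qed

text \<open>Modulo \<open>b\<close> the elements \<open>a\<close> and \<open>a \<ominus> b\<close>
  agree, hence so do their powers. When the difference is nilpotent, some power of \<open>a\<close>
  becomes a multiple of \<open>b\<close>.\<close>

lemma (in cring) pow_eq_pow_minus_add_multiple:
  assumes a: "a \<in> carrier R" and b: "b \<in> carrier R"
  shows "\<exists>w \<in> carrier R. a [^] (n::nat) = (a \<ominus> b) [^] n \<oplus> b \<otimes> w"
proof (induction n)
  case 0
  show ?case using a b by (intro bexI[of _ \<zero>]) auto
next
  case (Suc n)
  then obtain w where w: "w \<in> carrier R" "a [^] n = (a \<ominus> b) [^] n \<oplus> b \<otimes> w" by blast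
  define c where "c = (a \<ominus> b) [^] n"
  have c: "c \<in> carrier R" using a b by (simp add: c_def)
  have "a [^] Suc n = (c \<oplus> b \<otimes> w) \<otimes> a"
    using w by (simp add: c_def)
  also have "\<dots> = c \<otimes> (a \<ominus> b) \<oplus> b \<otimes> (c \<oplus> w \<otimes> a)"
    using a b c w by algebra
  finally show ?case
    using a b c w by (intro bexI[of _ "c \<oplus> w \<otimes> a"]) (auto simp: c_def)
qed

lemma (in cring) genideal_empty: "Idl {} = {\<zero>}"
proof
  show "Idl {} \<subseteq> {\<zero>}"
    by (rule genideal_minimal[OF zeroideal]) simp
  show "{\<zero>} \<subseteq> Idl {}"
    using additive_subgroup.zero_closed[OF ideal.axioms(1)[OF genideal_ideal[of "{}"]]] by simp
qed

lemma (in primeideal) nilpotent_mem: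
  assumes "x \<in> carrier R" "x [^] (n::nat) = \<zero>"
  shows "x \<in> I"
proof -
  have "x [^] n \<in> I \<Longrightarrow> x \<in> I"
  proof (induction n)
    case 0
    then show ?case using I_notcarr one_imp_carrier by simp
  next
    case (Suc n)
    then show ?case using I_prime[of "x [^] n" x] assms by auto
  qed
  then show ?thesis using assms by simp
qed

lemma Sup_enat_eq_1I:
  assumes "P 1" "\<And>n. P n \<Longrightarrow> n \<le> 1"
  shows "Sup {enat n | n. P n} = 1"
proof (rule antisym)
  show "Sup {enat n | n. P n} \<le> 1"
    using assms(2) by (intro Sup_least) (auto simp: one_enat_def)
  show "1 \<le> Sup {enat n | n. P n}"
    using assms(1) by (intro Sup_upper) (auto simp: one_enat_def)
qed

text \<open>An embedding \<open>\<sigma>\<close> of k[T] with a ring retraction \<open>\<pi>\<close>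
  whose kernel is nil. The nil kernel controls the prime ideals, torsion-freeness supplies a regular
  element in each maximal ideal, and generation by the finite set \<open>E\<close> over k[T] gives
  the Noetherian property.\<close>

locale nil_extension_of_poly_ring = cring R for R (structure) +
  fixes \<sigma> :: "'k::field poly \<Rightarrow> 'a" and \<pi> :: "'a \<Rightarrow> 'k poly" and E :: "'a set"
  assumes sigma_closed [simp, intro]: "\<sigma> p \<in> carrier R"
    and sigma_add: "\<sigma> (p + q) = \<sigma> p \<oplus> \<sigma> q"
    and sigma_mult: "\<sigma> (p * q) = \<sigma> p \<otimes> \<sigma> q"
    and sigma_one [simp]: "\<sigma> 1 = \<one>"
    and pi_add: "x \<in> carrier R \<Longrightarrow> y \<in> carrier R \<Longrightarrow> \<pi> (x \<oplus> y) = \<pi> x + \<pi> y"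
    and pi_mult: "x \<in> carrier R \<Longrightarrow> y \<in> carrier R \<Longrightarrow> \<pi> (x \<otimes> y) = \<pi> x * \<pi> y"
    and pi_sigma [simp]: "\<pi> (\<sigma> p) = p"
    and nilpotent_kernel: "x \<in> carrier R \<Longrightarrow> \<pi> x = 0 \<Longrightarrow> \<exists>n::nat. x [^] n = \<zero>"
    and torsion_free: "x \<in> carrier R \<Longrightarrow> p \<noteq> 0 \<Longrightarrow> \<sigma> p \<otimes> x = \<zero> \<Longrightarrow> x = \<zero>"
    and finite_E: "finite E" and E_carrier: "E \<subseteq> carrier R"
    and span_E: "carrier R \<subseteq> module_span R \<sigma> E"
begin

lemma sigma_zero [simp]: "\<sigma> 0 = \<zero>"
  using sigma_add[of 0 0] by (metis add.r_cancel_one' add_0 sigma_closed)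

lemma sigma_uminus: "\<sigma> (- p) = \<ominus> \<sigma> p"
  using sigma_add[of "- p" p] by (simp add: minus_equality)

lemma sigma_diff: "\<sigma> (p - q) = \<sigma> p \<ominus> \<sigma> q"
  using sigma_add[of p "- q"] by (simp add: sigma_uminus a_minus_def)

lemma sigma_pow: "\<sigma> (p ^ n) = \<sigma> p [^] n"
  by (induction n) (simp_all add: sigma_mult m_comm)

lemma pi_zero [simp]: "\<pi> \<zero> = 0"
  using pi_sigma[of 0] by simp

lemma pi_one [simp]: "\<pi> \<one> = 1"
  using pi_sigma[of 1] by simp

lemma pi_uminus: "x \<in> carrier R \<Longrightarrow> \<pi> (\<ominus> x) = - \<pi> x"
  using pi_add[of "\<ominus> x" x] by (simp add: l_neg eq_neg_iff_add_eq_0)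

lemma pi_diff: "x \<in> carrier R \<Longrightarrow> y \<in> carrier R \<Longrightarrow> \<pi> (x \<ominus> y) = \<pi> x - \<pi> y"
  by (simp add: a_minus_def pi_add pi_uminus)

section \<open>Prime ideals and height\<close>

lemma ideal_generator:
  assumes "ideal J R"
  obtains g where "\<sigma> g \<in> J" "\<And>p. \<sigma> p \<in> J \<Longrightarrow> g dvd p"
proof -
  interpret ideal J R by fact
  show ?thesis
  proof (rule poly_ideal_principal[of "{p. \<sigma> p \<in> J}"])
    show "p - q \<in> {p. \<sigma> p \<in> J}" if "p \<in> {p. \<sigma> p \<in> J}" "q \<in> {p. \<sigma> p \<in> J}" for p q
      using that by (simp add: sigma_diff a_minus_def)
  qed (use that in \<open>auto simp: sigma_mult I_l_closed\<close>)
qed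

text \<open>\<open>x\<close> and \<open>\<sigma> (\<pi> x)\<close> differ by an element of the
  kernel of \<open>\<pi>\<close>, which is nilpotent and so lies in every prime. A prime is
  therefore determined by its contraction to k[T].\<close>

lemma prime_mem_iff:
  assumes "primeideal P R" "x \<in> carrier R"
  shows "x \<in> P \<longleftrightarrow> \<sigma> (\<pi> x) \<in> P"
proof -
  interpret primeideal P R by fact
  define d where "d = x \<ominus> \<sigma> (\<pi> x)"
  have d: "d \<in> carrier R" using assms by (simp add: d_def)
  have "\<pi> d = 0" using assms by (simp add: d_def pi_diff)
  with d have "d \<in> P" using nilpotent_kernel nilpotent_mem by blast
  moreover have "x = d \<oplus> \<sigma> (\<pi> x)" "\<sigma> (\<pi> x) = x \<ominus> d"
    using assms(2) sigma_closed[of "\<pi> x"] unfolding d_def by algebra+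
  ultimately show ?thesis
    by (metis a_closed a_inv_closed a_minus_def)
qed

abbreviation "nilrad \<equiv> {x \<in> carrier R. \<pi> x = 0}"

text \<open>The preimage under \<open>\<pi>\<close> of the ideal (g). For \<open>g = 0\<close> it is
  \<open>nilrad\<close>, as \<open>0 dvd p\<close> means \<open>p = 0\<close>; a nonconstant
  \<open>g\<close> gives a proper ideal strictly above it.\<close>

lemma pi_multiples_ideal: "ideal {x \<in> carrier R. g dvd \<pi> x} R"
proof (rule idealI)
  show "subgroup {x \<in> carrier R. g dvd \<pi> x} (add_monoid R)"
    by (rule add.subgroupI) (auto simp: pi_add pi_uminus simp flip: a_inv_def intro: exI[of _ \<zero>])
qed (auto simp: pi_mult ring_axioms)

lemma nilrad_prime: "primeideal nilrad R"
proof (rule primeidealI)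
  show "ideal nilrad R" using pi_multiples_ideal[of 0] by simp
  show "carrier R \<noteq> nilrad" using one_closed pi_one by force
qed (auto simp: pi_mult is_cring)

lemma nilrad_subset_prime: "primeideal P R \<Longrightarrow> nilrad \<subseteq> P"
  using nilpotent_kernel primeideal.nilpotent_mem by fast

text \<open>A prime without nonzero polynomials is \<open>nilrad\<close>, which is not maximal: the
  preimage of (T) lies strictly between it and the whole ring.\<close>

lemma maximal_contains_poly:
  assumes "maximalideal M R"
  obtains p where "p \<noteq> 0" "\<sigma> p \<in> M"
proof -
  interpret maximalideal M R by fact
  interpret M: primeideal M R by (rule maximalideal_prime) fact
  have "\<exists>x \<in> M. \<pi> x \<noteq> 0"
  proof (rule ccontr)
    assume "\<not> ?thesis"
    then have M: "M = nilrad"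
      using nilrad_subset_prime[OF M.primeideal] Icarr by auto
    define g :: "'k poly" where "g = [:0, 1:]"
    define J where "J = {x \<in> carrier R. g dvd \<pi> x}"
    have "M \<subseteq> J" "J \<subseteq> carrier R" unfolding M J_def by auto
    then have "J = M \<or> J = carrier R"
      using I_maximal pi_multiples_ideal[of g] by (simp add: J_def)
    moreover have "\<sigma> g \<in> J" unfolding J_def by simp
    moreover have "g \<noteq> 0" by (simp add: g_def)
    then have "\<pi> (\<sigma> g) \<noteq> 0" by simp
    then have "\<sigma> g \<notin> M" unfolding M by blast
    moreover have "\<not> g dvd 1" 
      by (simp add: g_def is_unit_poly_iff)
    then have "\<one> \<notin> J"
      unfolding J_def by simp
    ultimately show False using one_closed by blast
  qed
  then show ?thesis using prime_mem_iff[OF M.primeideal] Icarr that by blast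
qed

text \<open>One-dimensionality of k[T], carried over to \<open>R\<close>. The contractions are
  generated by \<open>g\<close> and \<open>g'\<close> with \<open>g = g' * h\<close> and
  \<open>g\<close> nonzero. Primality puts \<open>g'\<close> or \<open>h\<close> into the smaller
  one: the first makes the contractions equal, the second makes \<open>g'\<close> a unit.\<close>

lemma prime_with_poly_not_below_prime:
  assumes P: "primeideal P R" and P': "primeideal P' R" and "P \<subseteq> P'"
    and p: "p \<noteq> 0" "\<sigma> p \<in> P"
  shows "P = P'"
proof -
  interpret P: primeideal P R by fact
  interpret P': primeideal P' R by fact
  obtain g where g: "\<sigma> g \<in> P" "\<And>p. \<sigma> p \<in> P \<Longrightarrow> g dvd p"
    using ideal_generator[OF P.is_ideal] by blast
  obtain g' where g': "\<sigma> g' \<in> P'" "\<And>p. \<sigma> p \<in> P' \<Longrightarrow> g' dvd p"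
    using ideal_generator[OF P'.is_ideal] by blast
  have "g \<noteq> 0" using g(2)[OF p(2)] p(1) by auto
  obtain h where h: "g = g' * h" using g(1) g'(2) \<open>P \<subseteq> P'\<close> by blast
  have "\<sigma> g' \<in> P \<or> \<sigma> h \<in> P"
    using P.I_prime[of "\<sigma> g'" "\<sigma> h"] g(1) by (simp add: h sigma_mult)
  then show ?thesis
  proof
    assume "\<sigma> g' \<in> P"
    have "x \<in> P" if "x \<in> P'" for x
    proof -
      have x: "x \<in> carrier R" using that P'.Icarr by blast
      then have "\<sigma> (\<pi> x) \<in> P'" using prime_mem_iff[OF P'] that by blast
      then obtain u where "\<pi> x = g' * u" using g'(2) by blast
      then have "\<sigma> (\<pi> x) \<in> P" using \<open>\<sigma> g' \<in> P\<close> by (simp add: sigma_mult P.I_r_closed)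
      then show ?thesis using prime_mem_iff[OF P] x by blast
    qed
    with \<open>P \<subseteq> P'\<close> show ?thesis by blast
  next
    assume "\<sigma> h \<in> P"
    then obtain u where "h = g * u" using g(2) by blast
    then have "g * (g' * u) = g * 1" using h by (simp add: algebra_simps)
    then have "g' * u = 1" using \<open>g \<noteq> 0\<close> by simp
    then have "\<one> \<in> P'" using g'(1) P'.I_r_closed[of "\<sigma> g'" "\<sigma> u"] by (metis sigma_closed sigma_mult sigma_one)
    then show ?thesis using P'.one_imp_carrier P'.I_notcarr by blast
  qed
qed

lemma height_maximal:
  assumes "maximalideal M R"
  shows "ideal_height R M = 1"
proof -
  interpret M: maximalideal M R by fact
  have M: "primeideal M R" by (rule maximalideal_prime) fact
  have "n \<le> 1" if c: "\<forall>i\<le>n. primeideal (c i) R" "\<forall>i<n. c i \<subset> c (Suc i)" for n and c :: "nat \<Rightarrow> 'a set"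
  proof (rule ccontr)
    assume "\<not> n \<le> 1"
    then have pr: "primeideal (c 0) R" "primeideal (c 1) R" "primeideal (c 2) R"
      and c01: "c 0 \<subset> c 1" and c12: "c 1 \<subset> c 2"
      using c by (auto simp: numeral_2_eq_2)
    obtain x where x: "x \<in> c 1" "x \<notin> c 0" using c01 by blast
    have xc: "x \<in> carrier R"
      using x(1) ideal.Icarr[OF primeideal.axioms(1)[OF pr(2)]] by blast
    \<comment> \<open>Since \<open>x\<close> avoids \<open>c 0\<close>, it avoids the kernel of
      \<open>\<pi>\<close>; so \<open>c 1\<close> contains a nonzero polynomial and nothing prime
      lies strictly above it.\<close>
    then have "\<pi> x \<noteq> 0" using nilrad_subset_prime[OF pr(1)] x by blast
    moreover have "\<sigma> (\<pi> x) \<in> c 1" using prime_mem_iff[OF pr(2)] x xc by blast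
    ultimately show False
      using prime_with_poly_not_below_prime[OF pr(2,3)] c12 by blast
  qed
  moreover have "\<exists>c. (\<forall>i\<le>1. primeideal (c i) R) \<and> (\<forall>i<1. c i \<subset> c (Suc i)) \<and> c 1 = M"
  proof (intro exI conjI)
    let ?c = "\<lambda>i::nat. if i = 0 then nilrad else M"
    obtain p where "p \<noteq> 0" "\<sigma> p \<in> M" using maximal_contains_poly[OF assms] by blast
    then have "nilrad \<noteq> M" by auto
    then show "\<forall>i<1. ?c i \<subset> ?c (Suc i)" using nilrad_subset_prime[OF M] by auto
  qed (use nilrad_prime M in auto)
  ultimately show ?thesis
    unfolding ideal_height_def by (intro Sup_enat_eq_1I) blast+
qed

section \<open>Depth\<close>

lemma pow_eq_multiple:
  assumes "x \<in> carrier R"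
  shows "\<exists>n::nat. \<exists>w\<in>carrier R. x [^] n = \<sigma> (\<pi> x) \<otimes> w"
    and "\<exists>n::nat. \<exists>w\<in>carrier R. \<sigma> (\<pi> x) [^] n = x \<otimes> w"
proof -
  have *: "\<exists>n::nat. \<exists>w\<in>carrier R. a [^] n = b \<otimes> w"
    if ab: "a \<in> carrier R" "b \<in> carrier R" "\<pi> a = \<pi> b" for a b
  proof -
    obtain n :: nat where "(a \<ominus> b) [^] n = \<zero>"
      using nilpotent_kernel[of "a \<ominus> b"] ab pi_diff[of a b] by auto
    moreover obtain w where "w \<in> carrier R" "a [^] n = (a \<ominus> b) [^] n \<oplus> b \<otimes> w"
      using pow_eq_pow_minus_add_multiple[of a b n] ab by blast
    ultimately show ?thesis using ab by (metis l_zero m_closed)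
  qed
  show "\<exists>n::nat. \<exists>w\<in>carrier R. x [^] n = \<sigma> (\<pi> x) \<otimes> w"
    "\<exists>n::nat. \<exists>w\<in>carrier R. \<sigma> (\<pi> x) [^] n = x \<otimes> w"
    by (rule *; use assms in simp)+
qed

text \<open>The common factor is the generator \<open>g\<close> of the contraction of
  \<open>M\<close>: it divides \<open>P\<close> because (x) lies in \<open>M\<close>, and it divides
  \<open>\<pi> y\<close>. In general only a power of \<open>y\<close> is a multiple of
  \<open>\<sigma> (\<pi> y)\<close>, so \<open>y\<close> is cancelled repeatedly until
  \<open>\<sigma> P'\<close> with \<open>P = g * P'\<close> is left in (x).\<close>

lemma no_regular_pair:
  assumes M: "maximalideal M R" and x: "x \<in> M" and y: "y \<in> M"
    and x_reg: "\<And>z. z \<in> carrier R \<Longrightarrow> x \<otimes> z = \<zero> \<Longrightarrow> z = \<zero>"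
    and y_reg: "\<And>z. z \<in> carrier R \<Longrightarrow> y \<otimes> z \<in> Idl {x} \<Longrightarrow> z \<in> Idl {x}"
  shows False
proof -
  interpret M: maximalideal M R by fact
  have Mp: "primeideal M R" by (rule maximalideal_prime) fact
  have one: "\<one> \<notin> M" using M.one_imp_carrier M.I_notcarr by blast
  have xc: "x \<in> carrier R" and yc: "y \<in> carrier R" using x y M.Icarr by auto
  interpret J: ideal "Idl {x}" R by (rule genideal_ideal) (use xc in auto)
  have xJ: "x \<in> Idl {x}" using genideal_self[of "{x}"] xc by auto
  have JM: "Idl {x} \<subseteq> M" by (rule genideal_minimal[OF M.is_ideal]) (use x in auto)
  \<comment> \<open>Otherwise \<open>x\<close> would be nilpotent as well as regular, and cancelling
    its powers would give \<open>\<one> = \<zero>\<close>.\<close>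
  have "\<pi> x \<noteq> 0"
  proof
    assume "\<pi> x = 0"
    then obtain n :: nat where "x [^] n = \<zero>" using nilpotent_kernel xc by blast
    then have "\<one> = \<zero>"
    proof (induction n)
      case (Suc n)
      then show ?case using x_reg[of "x [^] n"] xc by (simp add: m_comm)
    qed simp
    then show False using one by simp
  qed
  obtain n :: nat and w where "w \<in> carrier R" "\<sigma> (\<pi> x) [^] n = x \<otimes> w"
    using pow_eq_multiple(2)[OF xc] by blast
  then have "\<sigma> (\<pi> x ^ n) \<in> Idl {x}" using xJ by (simp add: sigma_pow J.I_r_closed)
  moreover have "P = 0" if "\<sigma> P \<in> Idl {x}" for P
    using that
  proof (induction "Polynomial.degree P" arbitrary: P rule: less_induct)
    case less
    show ?case
    proof (rule ccontr)
      assume P: "P \<noteq> 0"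
      obtain g where g: "\<sigma> g \<in> M" "\<And>p. \<sigma> p \<in> M \<Longrightarrow> g dvd p"
        using ideal_generator[OF M.is_ideal] by blast
      obtain P' where P': "P = g * P'" using g(2) less.prems JM by blast
      have "\<sigma> (\<pi> y) \<in> M" using prime_mem_iff[OF Mp] y yc by blast
      then obtain y' where y': "\<pi> y = g * y'" using g(2) by blast
      have "\<not> g dvd 1"
        using one g(1) M.I_r_closed by (metis dvdE sigma_closed sigma_mult sigma_one)
      then have "Polynomial.degree g \<noteq> 0" using P P' by (auto simp: is_unit_iff_degree)
      then have deg: "Polynomial.degree P' < Polynomial.degree P"
        using P P' by (auto simp: Polynomial.degree_mult_eq)
      obtain n :: nat and w where w: "w \<in> carrier R" "y [^] n = \<sigma> (\<pi> y) \<otimes> w"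
        using pow_eq_multiple(1)[OF yc] by blast
      have "y [^] n \<otimes> \<sigma> P' = (\<sigma> y' \<otimes> w) \<otimes> (\<sigma> g \<otimes> \<sigma> P')"
        unfolding w(2) y' sigma_mult using w(1) sigma_closed[of y'] sigma_closed[of g] sigma_closed[of P']
        by algebra
      also have "\<dots> \<in> Idl {x}"
        using less.prems w(1) by (auto intro: J.I_l_closed simp: P' sigma_mult)
      finally have "y [^] n \<otimes> \<sigma> P' \<in> Idl {x}" .
      then have "\<sigma> P' \<in> Idl {x}"
      proof (induction n)
        case (Suc n)
        have "y \<otimes> (c \<otimes> d) = (c \<otimes> y) \<otimes> d" if "c \<in> carrier R" "d \<in> carrier R" for c d
          using that yc by algebra
        from this[of "y [^] n" "\<sigma> P'"] Suc.prems yc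
        have "y \<otimes> (y [^] n \<otimes> \<sigma> P') \<in> Idl {x}"
          by (simp del: m_assoc)
        then have "y [^] n \<otimes> \<sigma> P' \<in> Idl {x}"
          by (rule y_reg[rotated]) (use yc in simp)
        then show ?case by (rule Suc.IH)
      qed simp
      then show False using less.hyps[OF deg] P P' by simp
    qed
  qed
  ultimately have "\<pi> x ^ n = 0" by blast
  then show False using \<open>\<pi> x \<noteq> 0\<close> by simp
qed

lemma depth_maximal:
  assumes "maximalideal M R"
  shows "ideal_depth R M = 1"
proof -
  interpret M: maximalideal M R by fact
  have "length xs \<le> 1" if xs: "regular_sequence R xs" "set xs \<subseteq> M" for xs
  proof (rule ccontr)
    assume len: "\<not> length xs \<le> 1"
    then obtain x y zs where xs_eq: "xs = x # y # zs"
      by (cases xs; cases "tl xs") auto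
    have reg: "\<forall>i < length xs. \<forall>y \<in> carrier R.
       xs ! i \<otimes> y \<in> Idl (set (take i xs)) \<longrightarrow> y \<in> Idl (set (take i xs))"
      using xs(1) by (simp add: regular_sequence_def)
    show False
    proof (rule no_regular_pair[OF assms])
      show "z = \<zero>" if "z \<in> carrier R" "x \<otimes> z = \<zero>" for z
        using reg[rule_format, of 0 z] that by (simp add: xs_eq genideal_empty)
      show "z \<in> Idl {x}" if "z \<in> carrier R" "y \<otimes> z \<in> Idl {x}" for z
        using reg[rule_format, of 1 z] that by (simp add: xs_eq)
    qed (use xs(2) in \<open>auto simp: xs_eq\<close>)
  qed
  moreover have "\<exists>xs. length xs = 1 \<and> regular_sequence R xs \<and> set xs \<subseteq> M"
  proof -
    obtain p where p: "p \<noteq> 0" "\<sigma> p \<in> M" using maximal_contains_poly[OF assms] by blast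
    have "Idl {\<sigma> p} \<subseteq> M" by (rule genideal_minimal[OF M.is_ideal]) (use p in auto)
    then have "Idl {\<sigma> p} \<noteq> carrier R"
      using M.I_notcarr M.a_subset by blast
    then have "regular_sequence R [\<sigma> p]"
      using torsion_free p by (auto simp: regular_sequence_def genideal_empty)
    with p show ?thesis by (intro exI[of _ "[\<sigma> p]"]) simp
  qed
  moreover have "{enat (length xs) | xs. regular_sequence R xs \<and> set xs \<subseteq> M} =
    {enat n | n. \<exists>xs. length xs = n \<and> regular_sequence R xs \<and> set xs \<subseteq> M}"
    by blast
  ultimately show ?thesis
    unfolding ideal_depth_def by (simp only:) (intro Sup_enat_eq_1I, blast+)
qed

section \<open>Submodules of finitely generated modules\<close>

lemma module_span_carrier:
  assumes "F \<subseteq> carrier R"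
  shows "module_span R \<sigma> F \<subseteq> carrier R"
proof
  fix x assume "x \<in> module_span R \<sigma> F"
  then show "x \<in> carrier R" by induction (use assms in auto)
qed

lemma module_span_insert:
  assumes "insert e F \<subseteq> carrier R" "x \<in> module_span R \<sigma> (insert e F)"
  shows "\<exists>p. \<exists>y \<in> module_span R \<sigma> F. x = \<sigma> p \<otimes> e \<oplus> y"
  using assms(2)
proof induction
  case zero
  show ?case
    by (intro exI[of _ 0] bexI[of _ \<zero>]) (use assms in \<open>auto intro: module_span.zero\<close>)
next
  case (incl f)
  show ?case
  proof (cases "f = e")
    case True
    then show ?thesis
      by (intro exI[of _ 1] bexI[of _ \<zero>]) (use assms in \<open>auto intro: module_span.zero\<close>)
  next
    case False
    then show ?thesis
      by (intro exI[of _ 0] bexI[of _ f]) (use assms incl in \<open>auto intro: module_span.incl\<close>)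
  qed
next
  case (add x x')
  then obtain p y p' y' where *: "y \<in> module_span R \<sigma> F" "x = \<sigma> p \<otimes> e \<oplus> y"
    "y' \<in> module_span R \<sigma> F" "x' = \<sigma> p' \<otimes> e \<oplus> y'" by blast
  have "y \<in> carrier R" "y' \<in> carrier R" "e \<in> carrier R"
    using * module_span_carrier[of F] assms by auto
  then have "x \<oplus> x' = \<sigma> (p + p') \<otimes> e \<oplus> (y \<oplus> y')"
    unfolding * sigma_add using sigma_closed[of p] sigma_closed[of p'] by algebra
  then show ?case using * by (blast intro: module_span.add)
next
  case (scale x q)
  then obtain p y where *: "y \<in> module_span R \<sigma> F" "x = \<sigma> p \<otimes> e \<oplus> y" by blast
  have "y \<in> carrier R" "e \<in> carrier R"
    using * module_span_carrier[of F] assms by auto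
  then have "\<sigma> q \<otimes> x = \<sigma> (q * p) \<otimes> e \<oplus> \<sigma> q \<otimes> y"
    unfolding * sigma_mult using sigma_closed[of p] sigma_closed[of q] by algebra
  then show ?case using * by (blast intro: module_span.scale)
qed

text \<open>
  As for submodules of free modules over a PID: the coefficients at the last generator \<open>e\<close> of the
  elements of \<open>J\<close> form a principal ideal, which reduces the claim to the other generators.
\<close>

lemma submodule_finitely_generated:
  assumes "finite F" "F \<subseteq> carrier R" "ideal J R"
  shows "\<exists>G. finite G \<and> G \<subseteq> J \<and> J \<inter> module_span R \<sigma> F \<subseteq> module_span R \<sigma> G"
  using assms(1,2)
proof (induction F)
  case empty
  have "x = \<zero>" if "x \<in> module_span R \<sigma> {}" for x
    using that by induction auto
  then show ?case by (intro exI[of _ "{}"]) (auto intro: module_span.zero)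
next
  case (insert e F)
  interpret J: ideal J R by fact
  let ?S = "module_span R \<sigma> F"
  have e: "e \<in> carrier R" and SF: "?S \<subseteq> carrier R"
    using insert.prems module_span_carrier[of F] by auto
  from insert obtain G where G: "finite G" "G \<subseteq> J" "J \<inter> ?S \<subseteq> module_span R \<sigma> G" by auto
  let ?L = "{p. \<exists>y \<in> ?S. \<sigma> p \<otimes> e \<oplus> y \<in> J}"
  have minus: "x \<ominus> \<sigma> u \<otimes> y \<in> ?S" if "x \<in> ?S" "y \<in> ?S" for x y u
  proof -
    have "x \<ominus> \<sigma> u \<otimes> y = x \<oplus> \<sigma> (- u) \<otimes> y"
      using that SF by (auto simp: sigma_uminus l_minus a_minus_def)
    then show ?thesis using that by (auto intro: module_span.intros)
  qed
  have comb: "(\<sigma> p \<otimes> e \<oplus> y) \<ominus> \<sigma> u \<otimes> (\<sigma> q \<otimes> e \<oplus> z) = \<sigma> (p - u * q) \<otimes> e \<oplus> (y \<ominus> \<sigma> u \<otimes> z)"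
    if "y \<in> ?S" "z \<in> ?S" for p q u y z
  proof -
    have "y \<in> carrier R" "z \<in> carrier R" using that SF by auto
    then show ?thesis
      unfolding sigma_diff sigma_mult
      using e sigma_closed[of p] sigma_closed[of q] sigma_closed[of u] by algebra
  qed
  have Jminus: "x \<ominus> \<sigma> u \<otimes> y \<in> J" if "x \<in> J" "y \<in> J" for x y u
    using that by (simp add: a_minus_def J.I_l_closed)
  \<comment> \<open>This one closure property gives differences for \<open>u = 1\<close> and
    multiples for \<open>p = 0\<close>.\<close>
  have L: "p - u * q \<in> ?L" if "p \<in> ?L" "q \<in> ?L" for p q u
  proof -
    obtain y z where yz: "y \<in> ?S" "\<sigma> p \<otimes> e \<oplus> y \<in> J" "z \<in> ?S" "\<sigma> q \<otimes> e \<oplus> z \<in> J"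
      using \<open>p \<in> ?L\<close> \<open>q \<in> ?L\<close> by blast
    show ?thesis
      using Jminus[OF yz(2,4), of u] minus[OF yz(1,3), of u] by (auto simp: comb[OF yz(1,3)])
  qed
  have L0: "0 \<in> ?L"
    using e by (auto intro!: bexI[of _ \<zero>] module_span.zero)
  obtain g where g: "g \<in> ?L" "\<And>p. p \<in> ?L \<Longrightarrow> g dvd p"
  proof (rule poly_ideal_principal[of ?L])
    show "p - q \<in> ?L" if "p \<in> ?L" "q \<in> ?L" for p q
      using L[OF that, of 1] by simp
    show "u * p \<in> ?L" if "p \<in> ?L" for u p
      using L[OF L0 that, of "- u"] by simp
  qed (use L0 in auto)
  from g(1) obtain y0 where y0: "y0 \<in> ?S" "\<sigma> g \<otimes> e \<oplus> y0 \<in> J" by blast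
  let ?x0 = "\<sigma> g \<otimes> e \<oplus> y0"
  let ?G = "insert ?x0 G"
  have "x \<in> module_span R \<sigma> ?G" if x: "x \<in> J" "x \<in> module_span R \<sigma> (insert e F)" for x
  proof -
    obtain p y where py: "y \<in> ?S" "x = \<sigma> p \<otimes> e \<oplus> y"
      using module_span_insert[OF insert.prems x(2)] by blast
    then have "p \<in> ?L" using x(1) by blast
    then obtain u where u: "p = g * u" using g(2) by blast
    have x0: "?x0 \<in> carrier R" using y0(2) by (rule J.Icarr)
    \<comment> \<open>Subtracting this multiple of \<open>?x0\<close> removes the coordinate at
      \<open>e\<close>, which leaves an element covered by \<open>G\<close>.\<close>
    have "x \<ominus> \<sigma> u \<otimes> ?x0 = y \<ominus> \<sigma> u \<otimes> y0"
      unfolding py(2) comb[OF py(1) y0(1)]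
      using subsetD[OF SF minus[OF py(1) y0(1), of u]] e by (simp add: u mult.commute)
    with Jminus[OF x(1) y0(2), of u] minus[OF py(1) y0(1), of u]
    have "x \<ominus> \<sigma> u \<otimes> ?x0 \<in> module_span R \<sigma> G" using G(3) by auto
    then have d: "x \<ominus> \<sigma> u \<otimes> ?x0 \<in> module_span R \<sigma> ?G" using module_span_mono[of G ?G] by blast
    have "x = (x \<ominus> \<sigma> u \<otimes> ?x0) \<oplus> \<sigma> u \<otimes> ?x0"
      using x0 x(1) J.Icarr[of x] sigma_closed[of u] by algebra
    also have "\<dots> \<in> module_span R \<sigma> ?G"
      by (rule module_span.add[OF d module_span.scale[OF module_span.incl]]) simp
    finally show ?thesis .
  qed
  with G y0 show ?case by (intro exI[of _ ?G]) auto
qed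

text \<open>An ideal is in particular a k[T]-submodule of a finitely generated module, and its
  module generators also generate it as an ideal.\<close>

lemma noetherian: "noetherian_ring R"
proof (rule noetherian_ringI)
  fix J assume "ideal J R"
  then interpret J: ideal J R .
  obtain G where G: "finite G" "G \<subseteq> J" "J \<inter> module_span R \<sigma> E \<subseteq> module_span R \<sigma> G"
    using submodule_finitely_generated[OF finite_E E_carrier \<open>ideal J R\<close>] by blast
  have Gc: "G \<subseteq> carrier R" using G(2) J.a_subset by blast
  interpret K: ideal "Idl G" R by (rule genideal_ideal) fact
  have "x \<in> Idl G" if "x \<in> module_span R \<sigma> G" for x
    using that
  proof induction
    case (incl e)
    then show ?case using genideal_self[OF Gc] by blast
  qed (auto intro: K.I_l_closed)
  then have "J \<subseteq> Idl G" using G(3) span_E J.a_subset by blast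
  moreover have "Idl G \<subseteq> J" by (rule genideal_minimal[OF J.is_ideal G(2)])
  ultimately show "\<exists>A \<subseteq> carrier R. finite A \<and> J = Idl A" using G(1) Gc by blast
qed

theorem cohen_macaulay: "cohen_macaulay_ring R"
  unfolding cohen_macaulay_ring_def
  using is_cring noetherian height_maximal depth_maximal by simp

end


section \<open>Monomial ideals\<close>

text \<open>Infinite series are included, so this is larger than the linear span of the monomials
  when \<open>S\<close> is infinite.\<close>

definition supported :: "nat set \<Rightarrow> 'k::field fps set"
  where "supported S = {f. \<forall>n. fps_nth f n \<noteq> 0 \<longrightarrow> n \<in> S}"

definition sumset :: "nat set \<Rightarrow> nat set \<Rightarrow> nat set"
  where "sumset S T = {x + y | x y. x \<in> S \<and> y \<in> T}"

text \<open>The base value is \<open>H\<close> and not \<open>{0}\<close>, because the zeroth power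
  of an ideal is the whole ring.\<close>

fun nfold_sumset :: "nat set \<Rightarrow> nat set \<Rightarrow> nat \<Rightarrow> nat set" where
  "nfold_sumset H S 0 = H"
| "nfold_sumset H S (Suc n) = sumset (nfold_sumset H S n) S"

lemma sumsetI [intro]: "x \<in> S \<Longrightarrow> y \<in> T \<Longrightarrow> x + y \<in> sumset S T"
  by (auto simp: sumset_def)

lemma sumsetE [elim]:
  assumes "n \<in> sumset S T"
  obtains x y where "n = x + y" "x \<in> S" "y \<in> T"
  using assms by (auto simp: sumset_def)

lemma supportedD: "f \<in> supported S \<Longrightarrow> n \<notin> S \<Longrightarrow> fps_nth f n = 0"
  by (auto simp: supported_def)

lemma supportedI: "(\<And>n. n \<notin> S \<Longrightarrow> fps_nth f n = 0) \<Longrightarrow> f \<in> supported S"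
  by (auto simp: supported_def)

lemma supported_zero [simp]: "0 \<in> supported S"
  by (auto simp: supported_def)

lemma supported_add: "f \<in> supported S \<Longrightarrow> g \<in> supported S \<Longrightarrow> f + g \<in> supported S"
  by (auto simp: supported_def) (metis add.right_neutral)

lemma supported_uminus: "f \<in> supported S \<Longrightarrow> - f \<in> supported S"
  by (auto simp: supported_def)

lemma supported_sum: "(\<And>i. i \<in> N \<Longrightarrow> f i \<in> supported S) \<Longrightarrow> sum f N \<in> supported S"
  by (induction N rule: infinite_finite_induct) (auto intro: supported_add)

lemma supported_mono: "S \<subseteq> T \<Longrightarrow> supported S \<subseteq> supported T"
  by (auto simp: supported_def)

lemma supported_mult: "f \<in> supported S \<Longrightarrow> g \<in> supported T \<Longrightarrow> f * g \<in> supported (sumset S T)"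
proof (rule supportedI)
  fix n assume fg: "f \<in> supported S" "g \<in> supported T" and n: "n \<notin> sumset S T"
  have "fps_nth f i * fps_nth g (n - i) = 0" if "i \<in> {0..n}" for i
  proof (rule ccontr)
    assume "\<not> ?thesis"
    then have "i \<in> S" "n - i \<in> T" using fg by (auto simp: supported_def)
    with n that show False by (metis atLeastAtMost_iff le_add_diff_inverse sumsetI)
  qed
  then show "fps_nth (f * g) n = 0" unfolding fps_mult_nth by (intro sum.neutral) blast
qed

lemma fps_X_power_supported_iff [simp]: "(fps_X ^ n :: 'k::field fps) \<in> supported S \<longleftrightarrow> n \<in> S"
  by (auto simp: supported_def)

lemma supported_fps_const_mult: "f \<in> supported S \<Longrightarrow> fps_const c * f \<in> supported S"
  by (auto simp: supported_def)

lemma supported_inject: "supported S = (supported T :: 'k::field fps set) \<longleftrightarrow> S = T"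
  by (metis fps_X_power_supported_iff subsetI subset_antisym)

text \<open>Here \<open>i\<close> and \<open>j\<close> are only lower bounds for the orders, so the
  coefficients in the second claim may vanish. That makes taking the coefficient at such a bound
  multiplicative.\<close>

lemma fps_mult_nth_lowest:
  fixes f g :: "'a::comm_semiring_1 fps"
  assumes "\<And>k. k < i \<Longrightarrow> fps_nth f k = 0" "\<And>k. k < j \<Longrightarrow> fps_nth g k = 0"
  shows "k < i + j \<Longrightarrow> fps_nth (f * g) k = 0"
    and "fps_nth (f * g) (i + j) = fps_nth f i * fps_nth g j"
proof -
  show "fps_nth (f * g) k = 0" if "k < i + j"
    unfolding fps_mult_nth
  proof (rule sum.neutral, rule ballI)
    fix x assume "x \<in> {0..k}"
    then have "x < i \<or> k - x < j" using that by auto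
    then show "fps_nth f x * fps_nth g (k - x) = 0" using assms by auto
  qed
  have "fps_nth (f * g) (i + j) = (\<Sum>x\<in>{i}. fps_nth f x * fps_nth g (i + j - x))"
    unfolding fps_mult_nth
  proof (rule sum.mono_neutral_right)
    show "\<forall>x\<in>{0..i + j} - {i}. fps_nth f x * fps_nth g (i + j - x) = 0"
    proof
      fix x assume "x \<in> {0..i + j} - {i}"
      then have "x < i \<or> i + j - x < j" by auto
      then show "fps_nth f x * fps_nth g (i + j - x) = 0" using assms by auto
    qed
  qed auto
  then show "fps_nth (f * g) (i + j) = fps_nth f i * fps_nth g j" by simp
qed

lemma fps_const_sum: "fps_const (sum f N) = (\<Sum>i\<in>N. fps_const (f i))"
  by (induction N rule: infinite_finite_induct) (simp_all flip: fps_const_add)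

lemma coeff_Abs_poly_MOST:
  "\<forall>\<^sub>\<infinity>n. f n = 0 \<Longrightarrow> Polynomial.coeff (Abs_poly f) = f"
  by (rule Abs_poly_inverse) simp

locale semigroup_algebra =
  fixes H :: "nat set" and A :: "'k::field fps ring" and c :: nat
  assumes zero_H: "0 \<in> H" and add_H: "\<And>x y. x \<in> H \<Longrightarrow> y \<in> H \<Longrightarrow> x + y \<in> H"
    and A_eq: "A = semigroup_ring H"
    and conductor: "\<And>n. c \<le> n \<Longrightarrow> n \<in> H"
begin

lemma A_simps [simp]:
  "carrier A = supported H" "x \<otimes>\<^bsub>A\<^esub> y = x * y" "x \<oplus>\<^bsub>A\<^esub> y = x + y" "\<one>\<^bsub>A\<^esub> = 1" "\<zero>\<^bsub>A\<^esub> = 0"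
  by (auto simp: A_eq semigroup_ring_def ring_of_type_algebra_def supported_def)

sublocale A: cring A
  unfolding A_eq by (rule cring_semigroup_ring) (auto simp: zero_H add_H)

lemma A_uminus: "x \<in> supported H \<Longrightarrow> \<ominus>\<^bsub>A\<^esub> x = - x"
  by (rule A.minus_equality) (auto simp: supported_uminus)

lemma A_minus: "x \<in> supported H \<Longrightarrow> y \<in> supported H \<Longrightarrow> x \<ominus>\<^bsub>A\<^esub> y = x - y"
  by (simp add: a_minus_def A_uminus)

lemma A_finsum: "(\<And>i. i \<in> N \<Longrightarrow> f i \<in> supported H) \<Longrightarrow> finsum A f N = sum f N"
proof (induction N rule: infinite_finite_induct)
  case (infinite N)
  then show ?case by (simp add: finsum_def finprod_def)
next
  case empty
  then show ?case by simp
next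
  case (insert x F)
  then show ?case by (subst A.finsum_insert) auto
qed

section \<open>Products and powers of monomial ideals\<close>

text \<open>Semigroup ideals of \<open>H\<close>, the exponent sets of monomial ideals; the empty
  set, for the zero ideal, is included.\<close>

definition absorbing :: "nat set \<Rightarrow> bool"
  where "absorbing S \<longleftrightarrow> S \<subseteq> H \<and> (\<forall>x\<in>S. \<forall>y\<in>H. x + y \<in> S)"

lemma absorbing_sumset: "absorbing S \<Longrightarrow> absorbing T \<Longrightarrow> absorbing (sumset S T)"
  unfolding absorbing_def
proof (intro conjI subsetI ballI; elim conjE)
  fix n z assume "n \<in> sumset S T" "z \<in> H" and T: "\<forall>x\<in>T. \<forall>y\<in>H. x + y \<in> T"
  then obtain x y where "n = x + y" "x \<in> S" "y \<in> T" by (elim sumsetE)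
  then show "n + z \<in> sumset S T" using sumsetI[of x S "y + z" T] T \<open>z \<in> H\<close> by (simp add: add.assoc)
qed (use add_H in \<open>auto elim!: sumsetE\<close>)

lemma absorbing_H: "absorbing H"
  by (auto simp: absorbing_def add_H)

lemma absorbing_nfold: "absorbing S \<Longrightarrow> absorbing (nfold_sumset H S n)"
  by (induction n) (auto simp: absorbing_H absorbing_sumset)

lemma sumset_H: "absorbing S \<Longrightarrow> sumset H S = S"
proof (intro subset_antisym subsetI)
  fix n assume S: "absorbing S" and "n \<in> sumset H S"
  then obtain x y where "n = x + y" "x \<in> H" "y \<in> S" by (elim sumsetE)
  then show "n \<in> S" using S by (metis absorbing_def add.commute)
next
  fix n assume "n \<in> S"
  then show "n \<in> sumset H S" using sumsetI[OF zero_H, of n S] by simp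
qed

lemma ideal_supported:
  assumes "absorbing S"
  shows "ideal (supported S) A"
proof (rule idealI)
  have "S \<subseteq> H" using assms by (simp add: absorbing_def)
  then have sub: "supported S \<subseteq> (supported H :: 'k fps set)" by (rule supported_mono)
  show "subgroup (supported S) (add_monoid A)"
  proof (rule A.add.subgroupI)
    show "supported S \<noteq> ({} :: 'k fps set)" using supported_zero by blast
  qed (use sub in \<open>auto simp: supported_add supported_uminus A_uminus simp flip: a_inv_def\<close>)
  show "x \<otimes>\<^bsub>A\<^esub> a \<in> supported S" "a \<otimes>\<^bsub>A\<^esub> x \<in> supported S"
    if "a \<in> supported S" "x \<in> carrier A" for a x
    using supported_mult[of x H a S] that sumset_H[OF assms] by (auto simp: mult.commute)
qed (rule A.ring_axioms)

text \<open>A series may have infinitely many exponents, but a product ideal has only finite sums of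
  products; so finitely many left summands must serve for all exponents. With \<open>m\<close> in
  \<open>S\<close>, a left summand \<open>x \<ge> m + c\<close> can be replaced by \<open>m\<close>:
  the surplus \<open>x - m\<close> lies in \<open>H\<close> and is absorbed by
  \<open>T\<close>.\<close>

lemma sumset_finite_decomposition:
  assumes "absorbing S" "absorbing T"
  shows "\<exists>G. finite G \<and> G \<subseteq> S \<and> (\<forall>n\<in>sumset S T. \<exists>g\<in>G. g \<le> n \<and> n - g \<in> T)"
proof (cases "S = {}")
  case True
  then show ?thesis by (intro exI[of _ "{}"]) auto
next
  case False
  then obtain m where m: "m \<in> S" by blast
  let ?G = "insert m {g \<in> S. g < m + c}"
  have "\<exists>g\<in>?G. g \<le> n \<and> n - g \<in> T" if "n \<in> sumset S T" for n
  proof -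
    obtain x y where xy: "n = x + y" "x \<in> S" "y \<in> T" using \<open>n \<in> sumset S T\<close> by (rule sumsetE)
    show ?thesis
    proof (cases "x < m + c")
      case True
      with xy show ?thesis by (intro bexI[of _ x]) auto
    next
      case False
      then have "x - m \<in> H" using conductor by simp
      then have "y + (x - m) \<in> T" using xy(3) assms(2) by (auto simp: absorbing_def)
      with False xy(1) show ?thesis by (intro bexI[of _ m]) (auto simp: add.commute)
    qed
  qed
  with m show ?thesis by (intro exI[of _ ?G]) auto
qed

lemma ideal_prod_supported:
  assumes S: "absorbing S" and T: "absorbing T"
  shows "supported S \<cdot>\<^bsub>A\<^esub> supported T = supported (sumset S T)"
proof
  show "supported S \<cdot>\<^bsub>A\<^esub> supported T \<subseteq> supported (sumset S T)"
  proof
    fix x assume "x \<in> supported S \<cdot>\<^bsub>A\<^esub> supported T"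
    then show "x \<in> supported (sumset S T)"
      by induction (auto simp: supported_mult supported_add)
  qed
  obtain G where G: "finite G" "G \<subseteq> S" "\<forall>n\<in>sumset S T. \<exists>g\<in>G. g \<le> n \<and> n - g \<in> T"
    using sumset_finite_decomposition[OF S T] by blast
  then obtain \<phi> where \<phi>: "\<And>n. n \<in> sumset S T \<Longrightarrow> \<phi> n \<in> G \<and> \<phi> n \<le> n \<and> n - \<phi> n \<in> T"
    by metis
  show "supported (sumset S T) \<subseteq> supported S \<cdot>\<^bsub>A\<^esub> supported T"
  proof
    fix f :: "'k fps" assume f: "f \<in> supported (sumset S T)"
    \<comment> \<open>\<open>F g\<close> collects the terms of \<open>f\<close> whose exponent
      \<open>\<phi>\<close> assigns to \<open>g\<close>, divided by t^g. As \<open>G\<close> is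
      finite, this writes \<open>f\<close> as a finite sum of products.\<close>
    define F where "F g = Abs_fps (\<lambda>m. if \<phi> (m + g) = g then fps_nth f (m + g) else 0)" for g
    have sum_mem: "sum h N \<in> supported S \<cdot>\<^bsub>A\<^esub> supported T"
      if "\<And>i. i \<in> N \<Longrightarrow> h i \<in> supported S \<cdot>\<^bsub>A\<^esub> supported T" for h :: "nat \<Rightarrow> 'k fps" and N
      using that
    proof (induction N rule: infinite_finite_induct)
      case (insert i N)
      then show ?case using ideal_prod.sum[of "h i" A _ _ "sum h N"] by simp
    qed (use ideal_prod.prod[of 0 _ 0 _ A] in simp_all)
    have "F g \<in> supported T" for g
    proof (rule supportedI)
      fix m assume "m \<notin> T"
      then show "fps_nth (F g) m = 0"
        using f \<phi>[of "m + g"] by (auto simp: F_def supported_def)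
    qed
    then have "fps_X ^ g * F g \<in> supported S \<cdot>\<^bsub>A\<^esub> supported T" if "g \<in> G" for g
      using ideal_prod.prod[of "fps_X ^ g" "supported S" "F g" "supported T" A] that G(2) by auto
    then have "(\<Sum>g\<in>G. fps_X ^ g * F g) \<in> supported S \<cdot>\<^bsub>A\<^esub> supported T"
      by (rule sum_mem)
    moreover have "(\<Sum>g\<in>G. fps_X ^ g * F g) = f"
    proof (rule fps_ext)
      fix n
      have "fps_nth (\<Sum>g\<in>G. fps_X ^ g * F g) n = (\<Sum>g\<in>G. if n < g then 0 else fps_nth (F g) (n - g))"
        by (simp add: fps_sum_nth fps_X_power_mult_nth)
      also have "\<dots> = (\<Sum>g\<in>G. if g = \<phi> n then fps_nth f n else 0)"
        using f \<phi>[of n] by (intro sum.cong) (auto simp: F_def supported_def)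
      also have "\<dots> = fps_nth f n"
        using f \<phi>[of n] G(1) by (auto simp: supported_def sum.delta)
      finally show "fps_nth (\<Sum>g\<in>G. fps_X ^ g * F g) n = fps_nth f n" .
    qed
    ultimately show "f \<in> supported S \<cdot>\<^bsub>A\<^esub> supported T" by simp
  qed
qed

lemma ideal_pow_supported:
  assumes "absorbing S"
  shows "ideal_pow A (supported S) n = supported (nfold_sumset H S n)"
proof (induction n)
  case 0
  show ?case unfolding nat_pow_def ideals_set_def by simp
next
  case (Suc n)
  have "ideal_pow A (supported S) (Suc n) = ideal_pow A (supported S) n \<cdot>\<^bsub>A\<^esub> supported S"
    unfolding nat_pow_def ideals_set_def by simp
  also have "\<dots> = supported (nfold_sumset H S (Suc n))"
    using Suc ideal_prod_supported[OF absorbing_nfold[OF assms] assms] by simp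
  finally show ?case .
qed

lemma absorbing_translate: "s \<in> H \<Longrightarrow> absorbing (sumset {s} H)"
  using add_H by (fastforce simp: absorbing_def sumset_def add.assoc)

lemma genideal_fps_X_power:
  assumes "s \<in> H"
  shows "Idl\<^bsub>A\<^esub> {fps_X ^ s} = supported (sumset {s} H)"
proof
  show "Idl\<^bsub>A\<^esub> {fps_X ^ s} \<subseteq> supported (sumset {s} H)"
    by (rule A.genideal_minimal[OF ideal_supported[OF absorbing_translate[OF assms]]])
      (auto simp: sumset_def zero_H)
  have c: "fps_X ^ s \<in> carrier A" using assms by simp
  interpret J: ideal "Idl\<^bsub>A\<^esub> {fps_X ^ s}" A
    by (rule A.genideal_ideal) (use c in simp)
  have X: "fps_X ^ s \<in> Idl\<^bsub>A\<^esub> {fps_X ^ s}" using A.genideal_self[of "{fps_X ^ s}"] c by simp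
  show "supported (sumset {s} H) \<subseteq> Idl\<^bsub>A\<^esub> {fps_X ^ s}"
  proof
    fix f :: "'k fps" assume f: "f \<in> supported (sumset {s} H)"
    define g where "g = Abs_fps (\<lambda>m. fps_nth f (m + s))"
    have "g \<in> supported H" using f by (auto simp: g_def supported_def sumset_def)
    moreover have "f = fps_X ^ s * g"
    proof (rule fps_ext)
      fix n
      show "fps_nth f n = fps_nth (fps_X ^ s * g) n"
        using f by (auto simp: g_def supported_def sumset_def fps_X_power_mult_nth)
    qed
    ultimately show "f \<in> Idl\<^bsub>A\<^esub> {fps_X ^ s}" using J.I_r_closed[OF X, of g] by simp
  qed
qed

end


section \<open>The associated graded ring of a monomial ideal\<close>

text \<open>\<open>translate_cancel\<close> says that multiplication by t^s maps an element of the
  ring into I^(n+1) only if it lies in I^n: injectivity of T, read off from exponents. Since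
  \<open>s\<close> is the least element of \<open>S\<close>, the least exponent of I^n is
  \<open>n * s\<close>, which gives the projection to k[T].\<close>

locale graded_semigroup_algebra = semigroup_algebra H A c
  for H and A :: "'k::field fps ring" and c +
  fixes S :: "nat set" and s :: nat
  assumes absorbing_S: "absorbing S" and s_in_S: "s \<in> S" and s_pos: "0 < s"
    and s_least: "\<And>x. x \<in> S \<Longrightarrow> s \<le> x"
    and conductor_S: "\<And>x. s + c \<le> x \<Longrightarrow> x \<in> S"
    and translate_cancel: "\<And>n h. h \<in> H \<Longrightarrow> h + s \<in> nfold_sumset H S (Suc n) \<Longrightarrow> h \<in> nfold_sumset H S n"
begin

section \<open>Exponents of the powers of the ideal\<close>

abbreviation E where "E n \<equiv> nfold_sumset H S n"
abbreviation F :: "nat \<Rightarrow> 'k fps set" where "F n \<equiv> supported (E n)"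
abbreviation G where "G \<equiv> assoc_graded A (supported S)"

lemma E_subset_H: "E n \<subseteq> H"
  using absorbing_nfold[OF absorbing_S, of n] by (simp add: absorbing_def)

lemma E_absorb: "x \<in> E n \<Longrightarrow> y \<in> H \<Longrightarrow> x + y \<in> E n"
  using absorbing_nfold[OF absorbing_S, of n] by (simp add: absorbing_def)

lemma E_Suc_subset: "E (Suc n) \<subseteq> E n"
  using E_absorb absorbing_S by (auto simp: absorbing_def elim!: sumsetE)

lemma E_add: "x \<in> E i \<Longrightarrow> y \<in> E j \<Longrightarrow> x + y \<in> E (i + j)"
proof (induction j arbitrary: y)
  case 0
  then show ?case using E_absorb by simp
next
  case (Suc j)
  then obtain u v where "y = u + v" "u \<in> E j" "v \<in> S" by (auto elim: sumsetE)
  then show ?case using Suc.IH[of u] Suc.prems(1) sumsetI[of "x + u" "E (i + j)" v S]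
    by (simp add: add.assoc)
qed

lemma mult_s_in_E: "n * s \<in> E n"
proof (induction n)
  case (Suc n)
  then show ?case using sumsetI[OF _ s_in_S, of "n * s" "E n"] by (simp add: add.commute)
qed (simp add: zero_H)

lemma E_lower: "x \<in> E n \<Longrightarrow> n * s \<le> x"
proof (induction n arbitrary: x)
  case (Suc n)
  then obtain u v where "x = u + v" "u \<in> E n" "v \<in> S" by (auto elim: sumsetE)
  then show ?case using Suc.IH[of u] s_least[of v] by simp
qed simp

lemma E_conductor: "n * s + c \<le> x \<Longrightarrow> x \<in> E n"
  using E_absorb[OF mult_s_in_E, of "x - n * s" n] conductor[of "x - n * s"] by simp

lemma S_eq_E: "S = E 1"
  using sumset_H[OF absorbing_S] by simp

lemma ideal_pow_eq: "ideal_pow A (supported S) n = F n"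
  by (rule ideal_pow_supported[OF absorbing_S])

lemma ideal_F: "ideal (F n) A"
  by (rule ideal_supported[OF absorbing_nfold[OF absorbing_S]])

lemma F_subset: "F n \<subseteq> supported H"
  by (rule supported_mono[OF E_subset_H])

lemma F_carrier: "x \<in> F n \<Longrightarrow> x \<in> supported H"
  using F_subset by blast

lemma F_Suc: "x \<in> F (Suc n) \<Longrightarrow> x \<in> F n"
  using supported_mono[OF E_Suc_subset] by blast

lemma F_mult: "x \<in> F i \<Longrightarrow> y \<in> F j \<Longrightarrow> x * y \<in> F (i + j)"
  using supported_mult[of x "E i" y "E j"] supported_mono[of "sumset (E i) (E j)" "E (i + j)"]
  by (auto intro: E_add)

lemma F_nth_zero: "x \<in> F n \<Longrightarrow> k < n * s \<Longrightarrow> fps_nth x k = 0"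
  using E_lower[of k n] by (auto simp: supported_def)

lemma F_translate_cancel:
  assumes "x \<in> supported H" "fps_X ^ s * x \<in> F (Suc n)"
  shows "x \<in> F n"
proof (rule supportedI, rule ccontr)
  fix h assume "h \<notin> E n" "fps_nth x h \<noteq> 0"
  then have "h \<in> H" using assms(1) by (auto simp: supported_def)
  then have "h + s \<notin> E (Suc n)" using translate_cancel \<open>h \<notin> E n\<close> by blast
  then have "fps_nth (fps_X ^ s * x) (h + s) = 0" using assms(2) by (rule supportedD[rotated])
  with \<open>fps_nth x h \<noteq> 0\<close> show False by (simp add: fps_X_power_mult_nth)
qed

lemma F_translate_power_cancel:
  "x \<in> supported H \<Longrightarrow> fps_X ^ (d * s) * x \<in> F (n + d) \<Longrightarrow> x \<in> F n"
proof (induction d)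
  case (Suc d)
  have "fps_X ^ (d * s) \<in> supported H" using mult_s_in_E[of d] E_subset_H by auto
  then have "fps_X ^ (d * s) * x \<in> supported H"
    using Suc.prems(1) A.m_closed[of "fps_X ^ (d * s)" x] by simp
  moreover have "fps_X ^ s * (fps_X ^ (d * s) * x) \<in> F (Suc (n + d))"
    using Suc.prems(2) by (simp add: power_add mult.assoc)
  ultimately show ?case using F_translate_cancel Suc by blast
qed simp

declare nfold_sumset.simps(2) [simp del]

lemma G_simps:
  "carrier G = {f. (\<forall>n. \<exists>x\<in>F n. f n = F (Suc n) +>\<^bsub>A\<^esub> x) \<and> finite {n. f n \<noteq> F (Suc n)}}"
  "f \<otimes>\<^bsub>G\<^esub> g = (\<lambda>n. finsum (A Quot F (Suc n)) (\<lambda>i. rcoset_mult A (F (Suc n)) (f i) (g (n - i))) {..n})"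
  "\<one>\<^bsub>G\<^esub> = (\<lambda>n. if n = 0 then F 1 +>\<^bsub>A\<^esub> \<one>\<^bsub>A\<^esub> else F (Suc n))"
  "\<zero>\<^bsub>G\<^esub> = (\<lambda>n. F (Suc n))"
  "f \<oplus>\<^bsub>G\<^esub> g = (\<lambda>n. f n <+>\<^bsub>A\<^esub> g n)"
  unfolding assoc_graded_def ideal_pow_eq by simp_all

section \<open>Cosets and the ring structure\<close>

abbreviation coset :: "nat \<Rightarrow> 'k fps \<Rightarrow> 'k fps set"
  where "coset n x \<equiv> F n +>\<^bsub>A\<^esub> x"

lemma coset_eq_iff: "x \<in> supported H \<Longrightarrow> y \<in> supported H \<Longrightarrow> coset n x = coset n y \<longleftrightarrow> x - y \<in> F n"
  using A.quotient_eq_iff_same_a_r_cos[OF ideal_F, of x y n] by (simp add: A_minus)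

lemma coset_eq_F: "x \<in> F n \<Longrightarrow> coset n x = F n"
  using A.a_rcos_zero[OF ideal_F, of x n] .

lemma mem_coset_iff: "y \<in> coset n x \<longleftrightarrow> y - x \<in> F n"
proof
  assume "y \<in> coset n x"
  then show "y - x \<in> F n" by (auto simp: a_r_coset_def')
next
  assume "y - x \<in> F n"
  then show "y \<in> coset n x" by (auto simp: a_r_coset_def' intro!: bexI[of _ "y - x"])
qed

lemma mem_coset_carrier: "x \<in> F i \<Longrightarrow> y \<in> coset (Suc i) x \<Longrightarrow> y \<in> F i"
  using supported_add[of "y - x" "E i" x] F_Suc by (auto simp: mem_coset_iff)

text \<open>The factors are cosets of I^(i+1) and I^(j+1), while the modulus is I^(i+j+1).
  Independence of the representatives comes from u v - x y = (u - x) v + x (v - y), where both terms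
  lie in the modulus.\<close>

lemma rcoset_mult_coset:
  assumes "x \<in> F i" "y \<in> F j"
  shows "rcoset_mult A (F (Suc (i + j))) (coset (Suc i) x) (coset (Suc j) y) = coset (Suc (i + j)) (x * y)"
proof -
  have "coset (Suc (i + j)) (u * v) = coset (Suc (i + j)) (x * y)"
    if u: "u \<in> coset (Suc i) x" and v: "v \<in> coset (Suc j) y" for u v
  proof -
    have "(u - x) * v \<in> F (Suc i + j)"
      using u mem_coset_carrier[OF assms(2) v] by (intro F_mult) (simp_all add: mem_coset_iff)
    moreover have "x * (v - y) \<in> F (i + Suc j)"
      using v assms by (intro F_mult) (simp_all add: mem_coset_iff)
    ultimately have "(u - x) * v + x * (v - y) \<in> F (Suc (i + j))"
      by (intro supported_add) simp_all
    moreover have "(u - x) * v + x * (v - y) = u * v - x * y" by (simp add: algebra_simps)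
    moreover have "u * v \<in> F (i + j)" "x * y \<in> F (i + j)"
      using F_mult mem_coset_carrier[OF assms(1) u] mem_coset_carrier[OF assms(2) v] assms by auto
    ultimately show ?thesis by (subst coset_eq_iff) (auto dest: F_carrier)
  qed
  then have "rcoset_mult A (F (Suc (i + j))) (coset (Suc i) x) (coset (Suc j) y) =
    (\<Union>u \<in> coset (Suc i) x. \<Union>v \<in> coset (Suc j) y. coset (Suc (i + j)) (x * y))"
    unfolding rcoset_mult_def A_simps by (intro SUP_cong refl)
  moreover have "x \<in> coset (Suc i) x" "y \<in> coset (Suc j) y" by (simp_all add: mem_coset_iff)
  ultimately show ?thesis by auto
qed

text \<open>
  The associated graded ring inherits the ring laws from the Rees algebra, a subring of the
  polynomials over \<open>k[[t]]\<close>, along the projection \<open>\<psi>\<close>.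
\<close>

definition Rees :: "'k fps poly set"
  where "Rees = {P. \<forall>n. Polynomial.coeff P n \<in> F n}"

definition \<psi> :: "'k fps poly \<Rightarrow> nat \<Rightarrow> 'k fps set"
  where "\<psi> P = (\<lambda>n. coset (Suc n) (Polynomial.coeff P n))"

lemma ReesD: "P \<in> Rees \<Longrightarrow> Polynomial.coeff P n \<in> F n"
  by (simp add: Rees_def)

lemma Rees_zero [simp]: "0 \<in> Rees"
  by (simp add: Rees_def)

lemma Rees_one [simp]: "1 \<in> Rees"
  using fps_X_power_supported_iff[of 0 H, where ?'k = 'k] zero_H by (simp add: Rees_def coeff_1)

lemma Rees_add [simp]: "P \<in> Rees \<Longrightarrow> Q \<in> Rees \<Longrightarrow> P + Q \<in> Rees"
  by (simp add: Rees_def supported_add)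

lemma Rees_uminus [simp]: "P \<in> Rees \<Longrightarrow> - P \<in> Rees"
  by (simp add: Rees_def supported_uminus)

lemma Rees_mult [simp]:
  assumes "P \<in> Rees" "Q \<in> Rees"
  shows "P * Q \<in> Rees"
proof -
  have "Polynomial.coeff P i * Polynomial.coeff Q (n - i) \<in> F n" if "i \<le> n" for i n
    using F_mult[of _ i _ "n - i"] ReesD[OF assms(1), of i] ReesD[OF assms(2), of "n - i"] that by simp
  then show ?thesis by (auto simp: Rees_def coeff_mult intro!: supported_sum)
qed

lemma Rees_monom: "x \<in> F n \<Longrightarrow> Polynomial.monom x n \<in> Rees"
  by (simp add: Rees_def)

lemma Rees_sum: "(\<And>i. i \<in> N \<Longrightarrow> Q i \<in> Rees) \<Longrightarrow> sum Q N \<in> Rees"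
  by (induction N rule: infinite_finite_induct) auto

lemma psi_eq_iff:
  assumes "P \<in> Rees" "Q \<in> Rees"
  shows "\<psi> P = \<psi> Q \<longleftrightarrow> (\<forall>n. Polynomial.coeff P n - Polynomial.coeff Q n \<in> F (Suc n))"
  using assms by (simp add: \<psi>_def fun_eq_iff coset_eq_iff F_carrier[OF ReesD])

lemma psi_zero: "\<psi> 0 = \<zero>\<^bsub>G\<^esub>"
  by (simp add: \<psi>_def G_simps coset_eq_F)

lemma psi_eq_zero_iff: "P \<in> Rees \<Longrightarrow> \<psi> P = \<zero>\<^bsub>G\<^esub> \<longleftrightarrow> (\<forall>n. Polynomial.coeff P n \<in> F (Suc n))"
  using psi_eq_iff[of P 0] psi_zero by simp

lemma psi_one: "\<psi> 1 = \<one>\<^bsub>G\<^esub>"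
proof
  fix n
  show "\<psi> 1 n = \<one>\<^bsub>G\<^esub> n"
    by (simp add: \<psi>_def G_simps coeff_1 coset_eq_F)
qed

lemma psi_add:
  assumes "P \<in> Rees" "Q \<in> Rees"
  shows "\<psi> (P + Q) = \<psi> P \<oplus>\<^bsub>G\<^esub> \<psi> Q"
proof
  fix n
  have "Polynomial.coeff P n \<in> carrier A" "Polynomial.coeff Q n \<in> carrier A"
    using assms F_carrier[OF ReesD] by simp_all
  from ideal.a_rcos_sum[OF ideal_F this, of "Suc n"]
  show "\<psi> (P + Q) n = (\<psi> P \<oplus>\<^bsub>G\<^esub> \<psi> Q) n"
    by (simp add: \<psi>_def G_simps)
qed

text \<open>All summands of the convolution are cosets of the same I^(n+1), so their sum is the
  image under the quotient map of the sum that defines the coefficient of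
  \<open>P * Q\<close>.\<close>

lemma psi_mult:
  assumes P: "P \<in> Rees" and Q: "Q \<in> Rees"
  shows "\<psi> (P * Q) = \<psi> P \<otimes>\<^bsub>G\<^esub> \<psi> Q"
proof
  fix n
  let ?J = "F (Suc n)"
  let ?x = "Polynomial.coeff P" and ?y = "Polynomial.coeff Q"
  interpret h: ring_hom_cring A "A Quot ?J" "(+>\<^bsub>A\<^esub>) ?J"
    by (rule ideal.rcos_ring_hom_cring[OF ideal_F A.is_cring])
  have xy: "?x i * ?y (n - i) \<in> F n" if "i \<le> n" for i
    using F_mult[of _ i _ "n - i"] ReesD[OF P, of i] ReesD[OF Q, of "n - i"] that by simp
  have xy': "?x i * ?y (n - i) \<in> carrier A" if "i \<in> {..n}" for i
    using F_carrier[OF xy, of i] that by simp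
  have "(\<psi> P \<otimes>\<^bsub>G\<^esub> \<psi> Q) n =
    finsum (A Quot ?J) (\<lambda>i. rcoset_mult A ?J (\<psi> P i) (\<psi> Q (n - i))) {..n}"
    by (simp add: G_simps)
  also have "\<dots> = finsum (A Quot ?J) (\<lambda>i. coset (Suc n) (?x i * ?y (n - i))) {..n}"
  proof (rule h.S.finsum_cong')
    show "(\<lambda>i. coset (Suc n) (?x i * ?y (n - i))) \<in> {..n} \<rightarrow> carrier (A Quot ?J)"
      using xy' h.hom_closed by blast
    show "rcoset_mult A ?J (\<psi> P i) (\<psi> Q (n - i)) = coset (Suc n) (?x i * ?y (n - i))"
      if "i \<in> {..n}" for i
      using rcoset_mult_coset[OF ReesD[OF P, of i] ReesD[OF Q, of "n - i"]] that
      by (simp add: \<psi>_def)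
  qed simp
  also have "\<dots> = coset (Suc n) (finsum A (\<lambda>i. ?x i * ?y (n - i)) {..n})"
    by (rule h.hom_finsum[symmetric, unfolded o_def]) (use xy' in blast)
  also have "finsum A (\<lambda>i. ?x i * ?y (n - i)) {..n} = (\<Sum>i\<le>n. ?x i * ?y (n - i))"
    by (rule A_finsum) (use xy' in simp)
  also have "coset (Suc n) (\<Sum>i\<le>n. ?x i * ?y (n - i)) = \<psi> (P * Q) n"
    by (simp add: \<psi>_def coeff_mult)
  finally show "\<psi> (P * Q) n = (\<psi> P \<otimes>\<^bsub>G\<^esub> \<psi> Q) n" by simp
qed

lemma psi_closed: "P \<in> Rees \<Longrightarrow> \<psi> P \<in> carrier G"
proof -
  assume P: "P \<in> Rees"
  have "{n. \<psi> P n \<noteq> F (Suc n)} \<subseteq> {..Polynomial.degree P}"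
  proof
    fix n assume n: "n \<in> {n. \<psi> P n \<noteq> F (Suc n)}"
    have "\<not> Polynomial.degree P < n"
    proof
      assume "Polynomial.degree P < n"
      then have "Polynomial.coeff P n = 0" by (rule coeff_eq_0)
      with n show False by (simp add: \<psi>_def coset_eq_F)
    qed
    then show "n \<in> {..Polynomial.degree P}" by simp
  qed
  then have "finite {n. \<psi> P n \<noteq> F (Suc n)}" by (rule finite_subset) simp
  moreover have "\<exists>x\<in>F n. \<psi> P n = coset (Suc n) x" for n
    using ReesD[OF P, of n] by (auto simp: \<psi>_def)
  ultimately show ?thesis by (simp add: G_simps)
qed

text \<open>Representing each zero coset by \<open>0\<close> turns the family of representatives
  into a polynomial. A nonzero coefficient then has a nonzero class, so the leading term of
  \<open>P\<close> is not lost in \<open>f\<close>.\<close>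

lemma carrier_G_normal_form:
  assumes "f \<in> carrier G"
  obtains P where "P \<in> Rees" "f = \<psi> P" "\<And>n. Polynomial.coeff P n \<in> F (Suc n) \<Longrightarrow> Polynomial.coeff P n = 0"
proof -
  have f: "\<forall>n. \<exists>x\<in>F n. f n = coset (Suc n) x" "finite {n. f n \<noteq> F (Suc n)}"
    using assms by (simp_all add: G_simps)
  obtain x where x: "\<And>n. x n \<in> F n" "\<And>n. f n = coset (Suc n) (x n)" using f(1) by metis
  define P where "P = Abs_poly (\<lambda>n. if f n = F (Suc n) then 0 else x n)"
  have P: "Polynomial.coeff P = (\<lambda>n. if f n = F (Suc n) then 0 else x n)"
    unfolding P_def
  proof (rule coeff_Abs_poly_MOST)
    show "\<forall>\<^sub>\<infinity>n. (if f n = F (Suc n) then 0 else x n) = 0"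
      unfolding MOST_iff_cofinite by (rule finite_subset[OF _ f(2)]) auto
  qed
  show ?thesis
  proof (rule that[of P])
    show "P \<in> Rees" using x(1) by (simp add: Rees_def P)
    show "f = \<psi> P" using x(2) by (auto simp: \<psi>_def P fun_eq_iff coset_eq_F)
    show "Polynomial.coeff P n = 0" if "Polynomial.coeff P n \<in> F (Suc n)" for n
      using that x(2)[of n] coset_eq_F[of "x n" "Suc n"] by (auto simp: P split: if_splits)
  qed
qed

lemma carrier_G_cases:
  assumes "f \<in> carrier G"
  obtains P where "P \<in> Rees" "f = \<psi> P"
  using assms by (rule carrier_G_normal_form)

lemma cring_G: "cring G"
proof (rule cringI)
  show "abelian_group G"
  proof (rule abelian_groupI)
    show "\<zero>\<^bsub>G\<^esub> \<in> carrier G" using psi_closed[of 0] by (simp add: psi_zero)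
    show "\<exists>y\<in>carrier G. y \<oplus>\<^bsub>G\<^esub> x = \<zero>\<^bsub>G\<^esub>" if "x \<in> carrier G" for x
    proof -
      from that obtain P where P: "P \<in> Rees" "x = \<psi> P" by (rule carrier_G_cases)
      then have "\<psi> (- P) \<oplus>\<^bsub>G\<^esub> x = \<zero>\<^bsub>G\<^esub>" by (simp flip: psi_add psi_zero)
      with P show ?thesis by (intro bexI[of _ "\<psi> (- P)"]) (simp_all add: psi_closed)
    qed
  qed (auto elim!: carrier_G_cases simp: psi_closed ac_simps simp flip: psi_add psi_zero)
  show "Group.comm_monoid G"
  proof (rule Group.comm_monoidI)
    show "\<one>\<^bsub>G\<^esub> \<in> carrier G" using psi_closed[of 1] by (simp add: psi_one)
    show "x \<otimes>\<^bsub>G\<^esub> y \<in> carrier G" if "x \<in> carrier G" "y \<in> carrier G" for x y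
      using that by (auto elim!: carrier_G_cases simp: psi_closed simp flip: psi_mult)
    show "x \<otimes>\<^bsub>G\<^esub> y \<otimes>\<^bsub>G\<^esub> z = x \<otimes>\<^bsub>G\<^esub> (y \<otimes>\<^bsub>G\<^esub> z)"
      if "x \<in> carrier G" "y \<in> carrier G" "z \<in> carrier G" for x y z
      using that by (auto elim!: carrier_G_cases simp: mult.assoc simp flip: psi_mult)
    show "\<one>\<^bsub>G\<^esub> \<otimes>\<^bsub>G\<^esub> x = x" if "x \<in> carrier G" for x
      using that psi_mult[of 1] by (auto elim!: carrier_G_cases simp: psi_one)
    show "x \<otimes>\<^bsub>G\<^esub> y = y \<otimes>\<^bsub>G\<^esub> x" if "x \<in> carrier G" "y \<in> carrier G" for x y
      using that by (auto elim!: carrier_G_cases simp: mult.commute simp flip: psi_mult)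
  qed
  show "(x \<oplus>\<^bsub>G\<^esub> y) \<otimes>\<^bsub>G\<^esub> z = x \<otimes>\<^bsub>G\<^esub> z \<oplus>\<^bsub>G\<^esub> y \<otimes>\<^bsub>G\<^esub> z"
    if "x \<in> carrier G" "y \<in> carrier G" "z \<in> carrier G" for x y z
    using that by (auto elim!: carrier_G_cases simp: distrib_right simp flip: psi_mult psi_add)
qed

section \<open>The polynomial subring and the projection onto it\<close>

text \<open>\<open>lift_poly p\<close> represents \<open>p(T)\<close>, where \<open>T\<close> is the class of \<open>t^s\<close> in degree 1.\<close>

definition lift_poly :: "'k poly \<Rightarrow> 'k fps poly"
  where "lift_poly p = Abs_poly (\<lambda>n. fps_const (Polynomial.coeff p n) * fps_X ^ (n * s))"

lemma coeff_lift_poly [simp]: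
  "Polynomial.coeff (lift_poly p) n = fps_const (Polynomial.coeff p n) * fps_X ^ (n * s)"
proof -
  have "\<forall>\<^sub>\<infinity>n. fps_const (Polynomial.coeff p n) * fps_X ^ (n * s) = 0"
    using MOST_coeff_eq_0[of p] by (rule MOST_mono) simp
  then show ?thesis unfolding lift_poly_def by (subst coeff_Abs_poly_MOST) simp_all
qed

lemma lift_poly_Rees [simp]: "lift_poly p \<in> Rees"
  by (simp add: Rees_def supported_fps_const_mult mult_s_in_E)

lemma lift_poly_add: "lift_poly (p + q) = lift_poly p + lift_poly q"
  by (rule poly_eqI) (simp add: distrib_right flip: fps_const_add)

lemma lift_poly_one: "lift_poly 1 = 1"
  by (rule poly_eqI) (simp add: coeff_1)

lemma lift_poly_mult: "lift_poly (p * q) = lift_poly p * lift_poly q"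
proof (rule poly_eqI)
  fix n
  have *: "fps_const (Polynomial.coeff p i) * fps_X ^ (i * s) *
      (fps_const (Polynomial.coeff q (n - i)) * fps_X ^ ((n - i) * s)) =
    fps_const (Polynomial.coeff p i * Polynomial.coeff q (n - i)) * fps_X ^ (n * s)" if "i \<le> n" for i
  proof -
    have "i * s + (n - i) * s = n * s" using that by (simp flip: distrib_right)
    then have "(fps_X ^ (n * s) :: 'k fps) = fps_X ^ (i * s) * fps_X ^ ((n - i) * s)"
      by (simp flip: power_add)
    then show ?thesis by (simp add: mult_ac flip: fps_const_mult)
  qed
  then show "Polynomial.coeff (lift_poly (p * q)) n = Polynomial.coeff (lift_poly p * lift_poly q) n"
    unfolding coeff_lift_poly coeff_mult fps_const_sum sum_distrib_right
    by (intro sum.cong refl *[symmetric]) simp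
qed

definition \<sigma> :: "'k poly \<Rightarrow> nat \<Rightarrow> 'k fps set"
  where "\<sigma> p = \<psi> (lift_poly p)"

text \<open>Since \<open>n * s\<close> is the least exponent of I^n, this is the projection to k[T]
  that sends every monomial other than a power of T to zero.\<close>

definition lowest_poly :: "'k fps poly \<Rightarrow> 'k poly"
  where "lowest_poly P = Abs_poly (\<lambda>n. fps_nth (Polynomial.coeff P n) (n * s))"

lemma coeff_lowest_poly [simp]:
  "Polynomial.coeff (lowest_poly P) n = fps_nth (Polynomial.coeff P n) (n * s)"
proof -
  have "\<forall>\<^sub>\<infinity>n. fps_nth (Polynomial.coeff P n) (n * s) = 0"
    using MOST_coeff_eq_0[of P] by (rule MOST_mono) simp
  then show ?thesis unfolding lowest_poly_def by (subst coeff_Abs_poly_MOST) simp_all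
qed

lemma lowest_poly_add: "lowest_poly (P + Q) = lowest_poly P + lowest_poly Q"
  by (rule poly_eqI) simp

lemma lowest_poly_mult:
  assumes "P \<in> Rees" "Q \<in> Rees"
  shows "lowest_poly (P * Q) = lowest_poly P * lowest_poly Q"
proof (rule poly_eqI)
  fix n
  have "fps_nth (Polynomial.coeff P i * Polynomial.coeff Q (n - i)) (n * s) =
    fps_nth (Polynomial.coeff P i) (i * s) * fps_nth (Polynomial.coeff Q (n - i)) ((n - i) * s)"
    if "i \<le> n" for i
  proof -
    have "i * s + (n - i) * s = n * s" using that by (simp flip: distrib_right)
    then show ?thesis
      using fps_mult_nth_lowest(2)[of "i * s" "Polynomial.coeff P i" "(n - i) * s" "Polynomial.coeff Q (n - i)"]
        F_nth_zero[OF ReesD[OF assms(1)]] F_nth_zero[OF ReesD[OF assms(2)]] by simp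
  qed
  then show "Polynomial.coeff (lowest_poly (P * Q)) n = Polynomial.coeff (lowest_poly P * lowest_poly Q) n"
    by (simp add: coeff_mult fps_sum_nth)
qed

lemma lowest_poly_lift_poly: "lowest_poly (lift_poly p) = p"
  by (rule poly_eqI) simp

text \<open>Representatives in degree n differ by an element of I^(n+1), whose exponents are at
  least (n + 1) s; this exceeds n s because s is positive.\<close>

lemma lowest_poly_cong:
  assumes "P \<in> Rees" "Q \<in> Rees" "\<psi> P = \<psi> Q"
  shows "lowest_poly P = lowest_poly Q"
proof (rule poly_eqI)
  fix n
  have "Polynomial.coeff P n - Polynomial.coeff Q n \<in> F (Suc n)"
    using assms psi_eq_iff by blast
  then have "fps_nth (Polynomial.coeff P n - Polynomial.coeff Q n) (n * s) = 0"
    by (rule F_nth_zero) (use s_pos in simp)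
  then show "Polynomial.coeff (lowest_poly P) n = Polynomial.coeff (lowest_poly Q) n" by simp
qed

definition \<pi> :: "(nat \<Rightarrow> 'k fps set) \<Rightarrow> 'k poly"
  where "\<pi> f = lowest_poly (SOME P. P \<in> Rees \<and> f = \<psi> P)"

lemma pi_psi:
  assumes "P \<in> Rees"
  shows "\<pi> (\<psi> P) = lowest_poly P"
proof -
  let ?Q = "SOME Q. Q \<in> Rees \<and> \<psi> P = \<psi> Q"
  have "?Q \<in> Rees \<and> \<psi> P = \<psi> ?Q"
    by (rule someI[of _ P]) (use assms in simp)
  then show ?thesis unfolding \<pi>_def using assms by (intro lowest_poly_cong) auto
qed

section \<open>Nilpotence and torsion-freeness\<close>

text \<open>A filtration by excess: in degree \<open>n\<close> all exponents exceed the minimum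
  \<open>n * s\<close> of I^n by at least \<open>j\<close>. Excesses add under
  multiplication.\<close>

definition deep :: "nat \<Rightarrow> 'k fps poly set"
  where "deep j = {P \<in> Rees. \<forall>n k. k < n * s + j \<longrightarrow> fps_nth (Polynomial.coeff P n) k = 0}"

lemma deep_mult:
  assumes P: "P \<in> deep i" and Q: "Q \<in> deep j"
  shows "P * Q \<in> deep (i + j)"
proof -
  have "fps_nth (Polynomial.coeff P m * Polynomial.coeff Q (n - m)) k = 0"
    if "m \<le> n" "k < n * s + (i + j)" for m n k
  proof -
    have "m * s + (n - m) * s = n * s" using that(1) by (simp flip: distrib_right)
    then have "k < (m * s + i) + ((n - m) * s + j)" using that(2) by simp
    then show ?thesis
      by (rule fps_mult_nth_lowest(1)[rotated 2]) (use P Q in \<open>auto simp: deep_def\<close>)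
  qed
  then show ?thesis using assms by (auto simp: deep_def coeff_mult fps_sum_nth)
qed

lemma deep_power: "P \<in> deep 1 \<Longrightarrow> P ^ j \<in> deep j"
proof (induction j)
  case 0
  have "fps_nth (Polynomial.coeff (1 :: 'k fps poly) n) k = 0" if "k < n * s" for n k
    using that by (cases n) (simp_all add: coeff_1)
  then show ?case by (simp add: deep_def)
next
  case (Suc j)
  then show ?case using deep_mult[of P 1 "P ^ j" j] by simp
qed

lemma psi_power: "P \<in> Rees \<Longrightarrow> P ^ j \<in> Rees \<and> \<psi> (P ^ j) = \<psi> P [^]\<^bsub>G\<^esub> j"
proof (induction j)
  case 0
  then show ?case by (simp add: psi_one)
next
  case (Suc j)
  then show ?case using psi_mult[of "P ^ j" P] by (simp add: mult.commute)
qed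

text \<open>A vanishing \<open>lowest_poly\<close> means excess at least 1, so the power has excess
  at least s + c. In degree n its exponents are then at least (n + 1) s + c, from where on every
  exponent belongs to I^(n+1).\<close>

lemma nilpotent_of_lowest_poly_zero:
  assumes P: "P \<in> Rees" and "lowest_poly P = 0"
  shows "\<psi> P [^]\<^bsub>G\<^esub> (s + c) = \<zero>\<^bsub>G\<^esub>"
proof -
  have "fps_nth (Polynomial.coeff P n) k = 0" if "k < n * s + 1" for n k
  proof (cases "k = n * s")
    case True
    then show ?thesis using coeff_lowest_poly[of P n] \<open>lowest_poly P = 0\<close> by simp
  next
    case False
    with that show ?thesis using F_nth_zero[OF ReesD[OF P], of k n] by simp
  qed
  then have "P \<in> deep 1" using P by (simp add: deep_def)
  then have d: "P ^ (s + c) \<in> deep (s + c)" by (rule deep_power)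
  have "Polynomial.coeff (P ^ (s + c)) n \<in> F (Suc n)" for n
  proof (rule supportedI)
    fix k assume "k \<notin> E (Suc n)"
    then have "k < n * s + (s + c)" using E_conductor[of "Suc n" k] by fastforce
    then show "fps_nth (Polynomial.coeff (P ^ (s + c)) n) k = 0" using d by (simp add: deep_def)
  qed
  then show ?thesis using psi_eq_zero_iff[of "P ^ (s + c)"] psi_power[OF P, of "s + c"] by simp
qed

text \<open>The product is tested in its top degree, where only the leading coefficients meet. With
  the nonzero scalar removed and the power of t^s cancelled, the leading coefficient of
  \<open>P\<close> lies in the next power of the ideal, so the normal form makes it zero.\<close>

lemma sigma_torsion_free:
  assumes f: "f \<in> carrier G" and "p \<noteq> 0" and zero: "\<sigma> p \<otimes>\<^bsub>G\<^esub> f = \<zero>\<^bsub>G\<^esub>"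
  shows "f = \<zero>\<^bsub>G\<^esub>"
proof -
  obtain P where P: "P \<in> Rees" "f = \<psi> P"
    and nf: "\<And>n. Polynomial.coeff P n \<in> F (Suc n) \<Longrightarrow> Polynomial.coeff P n = 0"
    using carrier_G_normal_form[OF f] by blast
  let ?d = "Polynomial.degree p" and ?N = "Polynomial.degree P"
  have "Polynomial.degree (lift_poly p) = ?d"
  proof (rule antisym)
    show "Polynomial.degree (lift_poly p) \<le> ?d" by (rule degree_le) (simp add: coeff_eq_0)
    show "?d \<le> Polynomial.degree (lift_poly p)" by (rule le_degree) (use \<open>p \<noteq> 0\<close> in simp)
  qed
  then have lead: "Polynomial.coeff (lift_poly p * P) (?d + ?N) =
      fps_const (Polynomial.lead_coeff p) * fps_X ^ (?d * s) * Polynomial.lead_coeff P"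
    using coeff_mult_degree_sum[of "lift_poly p" P] by simp
  have "\<psi> (lift_poly p * P) = \<zero>\<^bsub>G\<^esub>"
    using zero P by (simp add: \<sigma>_def psi_mult)
  then have "fps_const (Polynomial.lead_coeff p) * fps_X ^ (?d * s) * Polynomial.lead_coeff P \<in> F (Suc (?d + ?N))"
    using psi_eq_zero_iff[of "lift_poly p * P"] P(1) lead by (metis Rees_mult lift_poly_Rees)
  then have "fps_const (inverse (Polynomial.lead_coeff p)) *
      (fps_const (Polynomial.lead_coeff p) * fps_X ^ (?d * s) * Polynomial.lead_coeff P) \<in> F (Suc (?d + ?N))"
    by (rule supported_fps_const_mult)
  also have "fps_const (inverse (Polynomial.lead_coeff p)) *
      (fps_const (Polynomial.lead_coeff p) * fps_X ^ (?d * s) * Polynomial.lead_coeff P) =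
    fps_X ^ (?d * s) * Polynomial.lead_coeff P"
    using \<open>p \<noteq> 0\<close> by (simp add: fps_const_mult_left[symmetric] mult.assoc[symmetric] fps_const_mult)
  finally have "fps_X ^ (?d * s) * Polynomial.lead_coeff P \<in> F (Suc ?N + ?d)"
    by (simp add: add.commute)
  then have "Polynomial.lead_coeff P \<in> F (Suc ?N)"
    using F_translate_power_cancel F_carrier[OF ReesD[OF P(1)]] by blast
  then have "Polynomial.lead_coeff P = 0" by (rule nf)
  then have "P = 0" by simp
  then show ?thesis by (simp add: P(2) psi_zero)
qed

section \<open>Finite generation over the polynomial ring\<close>

definition generators :: "(nat \<Rightarrow> 'k fps set) set"
  where "generators = {\<psi> (Polynomial.monom (fps_X ^ h) n) | h n. h \<in> E n \<and> h < s + c}"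

text \<open>For \<open>h \<in> E n\<close> one has n \<le> n s \<le> h, so the bound on the exponent
  also bounds the degree.\<close>

lemma finite_generators: "finite generators"
proof -
  have "generators \<subseteq> (\<lambda>(h, n). \<psi> (Polynomial.monom (fps_X ^ h) n)) ` ({..<s + c} \<times> {..<s + c})"
  proof
    fix f assume "f \<in> generators"
    then obtain h n where f: "f = \<psi> (Polynomial.monom (fps_X ^ h) n)" "h \<in> E n" "h < s + c"
      by (auto simp: generators_def)
    have "n \<le> n * s" using s_pos by simp
    then have "n < s + c" using E_lower[OF f(2)] f(3) by linarith
    with f show "f \<in> (\<lambda>(h, n). \<psi> (Polynomial.monom (fps_X ^ h) n)) ` ({..<s + c} \<times> {..<s + c})"
      by force
  qed
  then show ?thesis by (rule finite_subset) simp
qed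

abbreviation "span_G \<equiv> module_span G \<sigma> generators"

text \<open>A monomial with \<open>h \<ge> s + c\<close> is zero in degree 0, since t^h already lies
  in I. In positive degree \<open>translate_cancel\<close> exhibits it as T times the monomial with
  exponent \<open>h - s\<close> one degree lower.\<close>

lemma psi_monom_fps_X_power_span: "h \<in> E n \<Longrightarrow> \<psi> (Polynomial.monom (fps_X ^ h) n) \<in> span_G"
proof (induction h arbitrary: n rule: less_induct)
  case (less h)
  have R: "Polynomial.monom (fps_X ^ h) n \<in> Rees" using less.prems by (simp add: Rees_monom)
  show ?case
  proof (cases "h < s + c")
    case True
    then show ?thesis using less.prems by (auto simp: generators_def intro!: module_span.incl)
  next
    case h: False
    show ?thesis
    proof (cases n)
      case 0
      have "h \<in> E (Suc 0)" using h conductor_S S_eq_E by simp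
      then have "\<psi> (Polynomial.monom (fps_X ^ h) n) = \<zero>\<^bsub>G\<^esub>"
        using R by (auto simp: psi_eq_zero_iff 0)
      then show ?thesis by (simp add: module_span.zero)
    next
      case (Suc m)
      have "h - s \<in> H" using h by (intro conductor) simp
      moreover have "h - s + s \<in> E (Suc m)" using h less.prems Suc by simp
      ultimately have hs: "h - s \<in> E m" using translate_cancel by blast
      have "lift_poly [:0, 1:] = Polynomial.monom (fps_X ^ s) 1"
        by (rule poly_eqI) (simp add: coeff_pCons split: nat.split)
      then have "Polynomial.monom (fps_X ^ h) n = lift_poly [:0, 1:] * Polynomial.monom (fps_X ^ (h - s)) m"
        using h Suc by (simp add: mult_monom flip: power_add)
      then have "\<psi> (Polynomial.monom (fps_X ^ h) n) =
          \<sigma> [:0, 1:] \<otimes>\<^bsub>G\<^esub> \<psi> (Polynomial.monom (fps_X ^ (h - s)) m)"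
        using hs by (simp add: psi_mult Rees_monom \<sigma>_def)
      then show ?thesis
        using less.IH[of "h - s" m] hs h s_pos by (simp add: module_span.scale)
    qed
  qed
qed

lemma psi_sum_span:
  assumes "\<And>i. i \<in> N \<Longrightarrow> Q i \<in> Rees \<and> \<psi> (Q i) \<in> span_G"
  shows "\<psi> (sum Q N) \<in> span_G"
  using assms
proof (induction N rule: infinite_finite_induct)
  case (insert i N)
  then have "\<psi> (sum Q (insert i N)) = \<psi> (Q i) \<oplus>\<^bsub>G\<^esub> \<psi> (sum Q N)"
    by (simp add: psi_add Rees_sum)
  then show ?case using insert by (simp add: module_span.add)
qed (simp_all add: psi_zero module_span.zero)

lemma psi_monom_span:
  assumes x: "x \<in> F n"
  shows "\<psi> (Polynomial.monom x n) \<in> span_G"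
proof -
  \<comment> \<open>Exponents from (n + 1) s + c on lie in \<open>E (Suc n)\<close>, so modulo
    I^(n+1) only these finitely many terms of \<open>x\<close> matter.\<close>
  define N where "N = {h \<in> E n. h < Suc n * s + c}"
  have N: "finite N" "N \<subseteq> E n" by (auto simp: N_def)
  let ?Q = "\<lambda>h. lift_poly [:fps_nth x h:] * Polynomial.monom (fps_X ^ h) n"
  have mon: "Polynomial.monom (fps_X ^ h) n \<in> Rees" if "h \<in> N" for h
    using that N(2) by (intro Rees_monom) auto
  have Q: "?Q h \<in> Rees \<and> \<psi> (?Q h) \<in> span_G" if "h \<in> N" for h
    using mon[OF that] psi_monom_fps_X_power_span[of h n] that N(2)
    by (auto simp: psi_mult module_span.scale simp flip: \<sigma>_def)
  have lift_const: "lift_poly [:a:] = [:fps_const a:]" for a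
    by (rule poly_eqI) (simp add: coeff_pCons split: nat.split)
  have "Polynomial.coeff (Polynomial.monom x n) m - Polynomial.coeff (\<Sum>h\<in>N. ?Q h) m \<in> F (Suc m)" for m
  proof (cases "m = n")
    case True
    have "x - (\<Sum>h\<in>N. fps_const (fps_nth x h) * fps_X ^ h) \<in> F (Suc n)"
    proof (rule supportedI)
      fix k assume k: "k \<notin> E (Suc n)"
      then have "k < Suc n * s + c" using E_conductor[of "Suc n" k] by fastforce
      then have "k \<in> N \<or> fps_nth x k = 0" using x by (auto simp: N_def supported_def)
      moreover have "(\<Sum>h\<in>N. fps_nth x h * (if k = h then 1 else 0)) = (\<Sum>h\<in>N. if k = h then fps_nth x h else 0)"
        by (rule sum.cong) auto
      ultimately show "fps_nth (x - (\<Sum>h\<in>N. fps_const (fps_nth x h) * fps_X ^ h)) k = 0"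
        using N(1) by (auto simp: fps_sum_nth sum.delta')
    qed
    then show ?thesis using True by (simp add: coeff_sum lift_const)
  next
    case False
    then show ?thesis by (simp add: coeff_sum lift_const)
  qed
  then have "\<psi> (Polynomial.monom x n) = \<psi> (\<Sum>h\<in>N. ?Q h)"
    using Q by (subst psi_eq_iff) (auto intro: Rees_monom x Rees_sum)
  then show ?thesis using psi_sum_span[of N ?Q] Q by simp
qed

lemma carrier_G_span: "carrier G \<subseteq> span_G"
proof
  fix f assume "f \<in> carrier G"
  then obtain P where P: "P \<in> Rees" "f = \<psi> P" by (rule carrier_G_cases)
  have "\<psi> (\<Sum>i\<le>Polynomial.degree P. Polynomial.monom (Polynomial.coeff P i) i) \<in> span_G"
    by (rule psi_sum_span) (simp add: psi_monom_span Rees_monom ReesD[OF P(1)])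
  then show "f \<in> span_G" by (simp add: P(2) poly_as_sum_of_monoms)
qed

theorem cohen_macaulay_G: "cohen_macaulay_ring G"
proof -
  interpret G: cring G by (rule cring_G)
  interpret nil_extension_of_poly_ring G \<sigma> \<pi> generators
  proof
    show "\<sigma> p \<in> carrier G" for p by (simp add: \<sigma>_def psi_closed)
    show "\<sigma> (p + q) = \<sigma> p \<oplus>\<^bsub>G\<^esub> \<sigma> q" for p q by (simp add: \<sigma>_def lift_poly_add psi_add)
    show "\<sigma> (p * q) = \<sigma> p \<otimes>\<^bsub>G\<^esub> \<sigma> q" for p q by (simp add: \<sigma>_def lift_poly_mult psi_mult)
    show "\<sigma> 1 = \<one>\<^bsub>G\<^esub>" by (simp add: \<sigma>_def lift_poly_one psi_one)
    show "\<pi> (x \<oplus>\<^bsub>G\<^esub> y) = \<pi> x + \<pi> y" if "x \<in> carrier G" "y \<in> carrier G" for x y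
      using that by (auto elim!: carrier_G_cases simp: pi_psi lowest_poly_add simp flip: psi_add)
    show "\<pi> (x \<otimes>\<^bsub>G\<^esub> y) = \<pi> x * \<pi> y" if "x \<in> carrier G" "y \<in> carrier G" for x y
      using that by (auto elim!: carrier_G_cases simp: pi_psi lowest_poly_mult simp flip: psi_mult)
    show "\<pi> (\<sigma> p) = p" for p by (simp add: \<sigma>_def pi_psi lowest_poly_lift_poly)
    show "\<exists>n::nat. x [^]\<^bsub>G\<^esub> n = \<zero>\<^bsub>G\<^esub>" if "x \<in> carrier G" "\<pi> x = 0" for x
      using that nilpotent_of_lowest_poly_zero by (metis carrier_G_cases pi_psi)
    show "x = \<zero>\<^bsub>G\<^esub>" if "x \<in> carrier G" "p \<noteq> 0" "\<sigma> p \<otimes>\<^bsub>G\<^esub> x = \<zero>\<^bsub>G\<^esub>" for x p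
      using sigma_torsion_free that by blast
    show "generators \<subseteq> carrier G"
      by (auto simp: generators_def intro!: psi_closed Rees_monom)
  qed (rule finite_generators carrier_G_span)+
  show ?thesis by (rule cohen_macaulay)
qed

end


section \<open>Semigroups generated by two consecutive numbers\<close>

text \<open>\<open>u = \<alpha> + \<beta>\<close> counts all generators in the sum,
  \<open>v = \<beta>\<close> those equal to a + 1.\<close>

lemma semigroup_gen2_Suc_iff:
  "n \<in> semigroup_gen2 a (a + 1) \<longleftrightarrow> (\<exists>u v. n = a * u + v \<and> v \<le> u)"
proof
  assume "n \<in> semigroup_gen2 a (a + 1)"
  then obtain \<alpha> \<beta> where "n = \<alpha> * a + \<beta> * (a + 1)" by (auto simp: semigroup_gen2_def)
  then have "n = a * (\<alpha> + \<beta>) + \<beta>" by (simp add: algebra_simps)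
  then show "\<exists>u v. n = a * u + v \<and> v \<le> u" by (metis le_add2)
next
  assume "\<exists>u v. n = a * u + v \<and> v \<le> u"
  then obtain w v where "n = a * (v + w) + v" by (metis le_Suc_ex)
  then have "n = w * a + v * (a + 1)" by (simp add: algebra_simps)
  then show "n \<in> semigroup_gen2 a (a + 1)" unfolding semigroup_gen2_def by blast
qed

text \<open>Passing from any representation to Euclidean division can only raise \<open>u\<close>
  and lower \<open>v\<close>, so it suffices to test quotient and remainder.\<close>

lemma semigroup_gen2_Suc_mod_div_iff:
  assumes "0 < a"
  shows "n \<in> semigroup_gen2 a (a + 1) \<longleftrightarrow> n mod a \<le> n div a"
proof
  assume "n \<in> semigroup_gen2 a (a + 1)"
  then obtain u v where n: "n = a * u + v" "v \<le> u" unfolding semigroup_gen2_Suc_iff by blast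
  have "n mod a \<le> v" by (simp add: n)
  also have "\<dots> \<le> u" by fact
  also have "\<dots> \<le> n div a" using assms by (simp add: n)
  finally show "n mod a \<le> n div a" .
next
  assume "n mod a \<le> n div a"
  moreover have "n = a * (n div a) + n mod a" by simp
  ultimately show "n \<in> semigroup_gen2 a (a + 1)" unfolding semigroup_gen2_Suc_iff by blast
qed

lemma sumset_translate: "sumset (sumset {s} S) T = (+) s ` sumset S T"
proof (intro subset_antisym subsetI)
  fix n assume "n \<in> (+) s ` sumset S T"
  then obtain x y where "n = s + x + y" "x \<in> S" "y \<in> T" by (auto simp: add.assoc elim!: sumsetE)
  then show "n \<in> sumset (sumset {s} S) T" by blast
qed (auto simp: add.assoc elim!: sumsetE)

lemma Inf_enat_ge: "Inf {enat n | n. k \<le> n} = enat k"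
  by (intro antisym Inf_lower Inf_greatest) auto

locale consecutive_semigroup_algebra =
  fixes a :: nat and H :: "nat set" and A :: "'k::field fps ring"
  assumes a_ge_2: "2 \<le> a"
    and H_eq: "H = semigroup_gen2 a (a + 1)"
    and A_def: "A = semigroup_ring H"
begin

lemma H_iff: "n \<in> H \<longleftrightarrow> (\<exists>u v. n = a * u + v \<and> v \<le> u)"
  by (simp only: H_eq semigroup_gen2_Suc_iff)

lemma H_mod_div_iff: "n \<in> H \<longleftrightarrow> n mod a \<le> n div a"
  using a_ge_2 by (simp only: H_eq semigroup_gen2_Suc_mod_div_iff)

lemma H_I: "v \<le> u \<Longrightarrow> a * u + v \<in> H"
  by (auto simp: H_iff)

lemma H_reduced_iff: "v < a \<Longrightarrow> a * u + v \<in> H \<longleftrightarrow> v \<le> u"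
  by (simp add: H_mod_div_iff)

lemma H_reduced:
  assumes "n \<in> H"
  obtains u v where "n = a * u + v" "v \<le> u" "v < a"
  using that[of "n div a" "n mod a"] assms a_ge_2 by (simp add: H_mod_div_iff)

sublocale semigroup_algebra H A "a * (a - 1)"
proof
  show "0 \<in> H" using H_I[of 0 0] by simp
  show "x + y \<in> H" if xy: "x \<in> H" "y \<in> H" for x y
  proof -
    obtain u v u' v' where "x = a * u + v" "v \<le> u" "y = a * u' + v'" "v' \<le> u'"
      using xy by (auto simp: H_iff)
    then show ?thesis using H_I[of "v + v'" "u + u'"] by (simp add: algebra_simps)
  qed
  show "n \<in> H" if "a * (a - 1) \<le> n" for n
  proof -
    have "a - 1 \<le> n div a" using div_le_mono[OF that, of a] a_ge_2 by simp
    moreover have "n mod a < a" using a_ge_2 by simp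
    ultimately show ?thesis unfolding H_mod_div_iff by linarith
  qed
qed (rule A_def)

text \<open>The remainder is a - 1 and the quotient only a - 2.\<close>

lemma Frobenius_number_not_mem: "a * (a - 1) - 1 \<notin> H"
proof -
  obtain b where b: "a = b + 2" using a_ge_2 by (metis add.commute le_Suc_ex)
  define k where "k = b + 1"
  have eq: "a * (a - 1) - 1 = a * b + k" by (simp add: b k_def algebra_simps)
  have "k < a" by (simp add: b k_def)
  then show ?thesis by (simp only: eq H_reduced_iff) (simp add: k_def)
qed

section \<open>Powers of the maximal ideal and the colon ideal\<close>

definition level :: "nat \<Rightarrow> nat set"
  where "level n = {h \<in> H. a * n \<le> h}"

lemma level_0 [simp]: "level 0 = H"
  by (simp add: level_def)

lemma absorbing_ge: "absorbing {h \<in> H. k \<le> h}"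
  by (auto simp: absorbing_def add_H)

lemma absorbing_level: "absorbing (level n)"
  unfolding level_def by (rule absorbing_ge)

text \<open>To split n = a u + v with u \<ge> i + j, write u = i + w with w \<ge> j and distribute
  the remainder greedily: the first summand takes \<open>min v i\<close>, and what is left is at
  most w because v \<le> u.\<close>

lemma level_add: "sumset (level i) (level j) = level (i + j)"
proof (intro subset_antisym subsetI)
  fix n assume "n \<in> sumset (level i) (level j)"
  then show "n \<in> level (i + j)"
    by (auto simp: level_def add_H distrib_left elim!: sumsetE)
next
  fix n assume n: "n \<in> level (i + j)"
  then obtain u v where uv: "n = a * u + v" "v \<le> u" "v < a"
    by (auto simp: level_def elim: H_reduced)
  have "i + j \<le> u"
  proof (rule ccontr)
    assume "\<not> i + j \<le> u"
    then have "a * (u + 1) \<le> a * (i + j)" by (intro mult_left_mono) auto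
    then show False using n uv by (simp add: level_def)
  qed
  then obtain w where w: "u = i + w" "j \<le> w" by (metis add_le_cancel_left le_Suc_ex nat_le_iff_add add_leD1)
  define x where "x = a * i + min v i"
  define y where "y = a * w + (v - min v i)"
  have "x \<in> level i" by (simp add: x_def level_def H_I)
  have "y \<in> H" unfolding y_def by (rule H_I) (use uv(2) w in linarith)
  moreover have "a * j \<le> a * w" using w(2) by (rule mult_left_mono) simp
  then have "a * j \<le> y" unfolding y_def by (rule trans_le_add1)
  ultimately have "y \<in> level j" by (simp add: level_def)
  then have "x + y \<in> sumset (level i) (level j)" using \<open>x \<in> level i\<close> by (rule sumsetI[rotated])
  moreover have "n = x + y" by (simp add: x_def y_def uv(1) w(1) distrib_left)
  ultimately show "n \<in> sumset (level i) (level j)" by simp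
qed

lemma nfold_level: "nfold_sumset H (level k) n = level (n * k)"
  by (induction n) (simp_all add: level_add add.commute)

text \<open>Subtract a when the remainder is zero and a + 1 otherwise; the remainder stays at most
  the quotient.\<close>

lemma level_1: "level 1 = sumset {a} H \<union> sumset {a + 1} H"
proof (intro subset_antisym subsetI)
  fix n assume n: "n \<in> level 1"
  then obtain u v where uv: "n = a * u + v" "v \<le> u" "v < a"
    by (auto simp: level_def elim: H_reduced)
  have "u \<noteq> 0"
  proof
    assume "u = 0"
    then show False using n uv a_ge_2 by (simp add: level_def)
  qed
  then obtain w where w: "u = Suc w" using not0_implies_Suc by blast
  show "n \<in> sumset {a} H \<union> sumset {a + 1} H"
  proof (cases v)
    case 0
    have "a + (a * w + 0) \<in> sumset {a} H" by (intro sumsetI H_I) simp_all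
    then show ?thesis using uv w 0 by simp
  next
    case (Suc k)
    have "(a + 1) + (a * w + k) \<in> sumset {a + 1} H"
      by (intro sumsetI H_I) (use uv(2) w Suc in simp_all)
    moreover have "n = (a + 1) + (a * w + k)" using uv(1) w Suc by simp
    ultimately show ?thesis by blast
  qed
next
  fix n assume "n \<in> sumset {a} H \<union> sumset {a + 1} H"
  then obtain b h where "b = a \<or> b = a + 1" "h \<in> H" "n = b + h" by (elim UnE sumsetE) blast+
  moreover have "a \<in> H" "a + 1 \<in> H" using H_I[of 0 1] H_I[of 1 1] by simp_all
  ultimately show "n \<in> level 1" using add_H[of b h] by (auto simp: level_def)
qed

lemma maximal_ideal_eq: "Idl\<^bsub>A\<^esub> {fps_X ^ a, fps_X ^ (a + 1)} = supported (level 1)"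
proof
  have gens: "a \<in> H" "a + 1 \<in> H" using H_I[of 0 1] H_I[of 1 1] by simp_all
  show "Idl\<^bsub>A\<^esub> {fps_X ^ a, fps_X ^ (a + 1)} \<subseteq> supported (level 1)"
    by (rule A.genideal_minimal[OF ideal_supported[OF absorbing_level]])
      (use gens in \<open>auto simp: level_def simp del: power_Suc\<close>)
  let ?M = "Idl\<^bsub>A\<^esub> {fps_X ^ a, fps_X ^ (a + 1)}"
  have gens_carrier: "{fps_X ^ a, fps_X ^ (a + 1)} \<subseteq> carrier A"
    using gens fps_X_power_supported_iff[of "a + 1" H, where ?'k = 'k] by simp
  interpret M: ideal ?M A by (rule A.genideal_ideal[OF gens_carrier])
  have sub: "supported (sumset {b} H) \<subseteq> ?M" if "b \<in> {a, a + 1}" for b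
  proof -
    have "b \<in> H" using that gens by auto
    moreover have "Idl\<^bsub>A\<^esub> {fps_X ^ b} \<subseteq> ?M"
      by (rule A.genideal_minimal[OF M.is_ideal])
        (use A.genideal_self[OF gens_carrier] that in blast)
    ultimately show ?thesis by (simp add: genideal_fps_X_power)
  qed
  show "supported (level 1) \<subseteq> ?M"
  proof
    fix f :: "'k fps" assume f: "f \<in> supported (level 1)"
    \<comment> \<open>The terms with exponent in a + H go to \<open>g\<close>; by
      \<open>level_1\<close> the other exponents lie in (a + 1) + H.\<close>
    define g where "g = Abs_fps (\<lambda>n. if n \<in> sumset {a} H then fps_nth f n else 0)"
    have "g \<in> supported (sumset {a} H)" by (auto simp: g_def supported_def)
    then have "g \<in> ?M" using sub by blast
    moreover have "f - g \<in> supported (sumset {a + 1} H)"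
    proof (rule supportedI)
      fix n assume "n \<notin> sumset {a + 1} H"
      then show "fps_nth (f - g) n = 0" using f level_1 by (auto simp: g_def supported_def)
    qed
    then have "f - g \<in> ?M" using sub by blast
    ultimately have "g \<oplus>\<^bsub>A\<^esub> (f - g) \<in> ?M" by (rule M.a_closed)
    then show "f \<in> ?M" by simp
  qed
qed

lemma maximal_ideal_pow:
  "ideal_pow A (Idl\<^bsub>A\<^esub> {fps_X ^ a, fps_X ^ (a + 1)}) n = supported (level n)"
  using ideal_pow_supported[OF absorbing_level, of 1 n] nfold_level[of 1 n]
  by (simp only: maximal_ideal_eq) simp

lemma colon_eq:
  assumes s: "s \<in> H" "0 < s"
  shows "ideal_colon A (Idl\<^bsub>A\<^esub> {fps_X ^ s}) (supported (level (a - 1))) = supported {h \<in> H. s \<le> h}"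
proof (intro subset_antisym subsetI)
  fix x assume "x \<in> ideal_colon A (Idl\<^bsub>A\<^esub> {fps_X ^ s}) (supported (level (a - 1)))"
  then have x: "x \<in> supported H"
    and colon: "\<And>y. y \<in> supported (level (a - 1)) \<Longrightarrow> x * y \<in> supported (sumset {s} H)"
    by (simp_all add: ideal_colon_def genideal_fps_X_power[OF s(1)])
  show "x \<in> supported {h \<in> H. s \<le> h}"
  proof (rule supportedI, rule ccontr)
    fix h assume "h \<notin> {h \<in> H. s \<le> h}" and nz: "fps_nth x h \<noteq> 0"
    then have h: "h < s" using x by (auto simp: supported_def)
    \<comment> \<open>\<open>k\<close> moves h to s plus the Frobenius number, outside s + H. As h <
      s, it is at least a (a - 1), so t^k lies in the (a - 1)-st power of the maximal ideal.\<close>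
    define k where "k = s + (a * (a - 1) - 1) - h"
    \<comment> \<open>This keeps the subtraction of 1 in \<open>k\<close> from being
      truncated.\<close>
    have "2 * 1 \<le> a * (a - 1)" using a_ge_2 by (intro mult_le_mono) auto
    then have k: "a * (a - 1) \<le> k" "h + k = s + (a * (a - 1) - 1)" using h by (simp_all add: k_def)
    then have "fps_X ^ k \<in> supported (level (a - 1))" using conductor by (simp add: level_def)
    then have "x * fps_X ^ k \<in> supported (sumset {s} H)" by (rule colon)
    moreover have "fps_nth (x * fps_X ^ k) (h + k) \<noteq> 0"
      using nz by (simp add: fps_X_power_mult_right_nth)
    ultimately have "h + k \<in> sumset {s} H" by (auto simp: supported_def)
    then show False using k(2) Frobenius_number_not_mem by (auto simp: sumset_def)
  qed
next
  fix x :: "'k fps" assume x: "x \<in> supported {h \<in> H. s \<le> h}"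
  have "sumset {h \<in> H. s \<le> h} (level (a - 1)) \<subseteq> sumset {s} H"
  proof
    fix n assume "n \<in> sumset {h \<in> H. s \<le> h} (level (a - 1))"
    \<comment> \<open>The two lower bounds add up to s plus the conductor, so \<open>n - s\<close>
      lies in \<open>H\<close>.\<close>
    then have "s + a * (a - 1) \<le> n" by (auto simp: level_def elim!: sumsetE)
    then show "n \<in> sumset {s} H"
      using sumsetI[of s "{s}" "n - s" H] conductor[of "n - s"] by simp
  qed
  then have "x * y \<in> supported (sumset {s} H)" if "y \<in> supported (level (a - 1))" for y
    using supported_mult[OF x that] supported_mono by blast
  moreover have "x \<in> supported H" using x by (auto simp: supported_def)
  ultimately show "x \<in> ideal_colon A (Idl\<^bsub>A\<^esub> {fps_X ^ s}) (supported (level (a - 1)))"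
    by (simp add: ideal_colon_def genideal_fps_X_power[OF s(1)])
qed

lemma cohen_macaulay_assoc_graded_ge:
  assumes s: "s \<in> H" "0 < s"
    and cancel: "\<And>n h. h \<in> H \<Longrightarrow> h + s \<in> nfold_sumset H {h \<in> H. s \<le> h} (Suc n) \<Longrightarrow>
      h \<in> nfold_sumset H {h \<in> H. s \<le> h} n"
  shows "cohen_macaulay_ring (assoc_graded A (supported {h \<in> H. s \<le> h}))"
proof -
  interpret graded_semigroup_algebra H A "a * (a - 1)" "{h \<in> H. s \<le> h}" s
    by unfold_locales (use s cancel conductor absorbing_ge in auto)
  show ?thesis by (rule cohen_macaulay_G)
qed

text \<open>The n-th power has exponents \<open>level (n * l)\<close>, so cancelling t^(a l) amounts
  to subtracting a l from a lower bound.\<close>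

lemma cohen_macaulay_assoc_graded_level:
  assumes "1 \<le> l"
  shows "cohen_macaulay_ring (assoc_graded A (supported (level l)))"
  unfolding level_def
proof (rule cohen_macaulay_assoc_graded_ge, fold level_def)
  show "a * l \<in> H" using H_I[of 0 l] by simp
  show "0 < a * l" using assms a_ge_2 by simp
  show "h \<in> nfold_sumset H (level l) n"
    if "h \<in> H" "h + a * l \<in> nfold_sumset H (level l) (Suc n)" for h n
    using that unfolding nfold_level by (simp add: level_def distrib_left)
qed

section \<open>The case s = (a + 1) l\<close>

text \<open>For \<open>s = (a + 1) l\<close> one has \<open>I = (t^s) + m^(l+1)\<close>; these are the exponents of \<open>I^n\<close>.\<close>

definition mixed_level :: "nat \<Rightarrow> nat \<Rightarrow> nat set"
  where "mixed_level l n = {i * ((a + 1) * l) + h | i h. i \<le> n \<and> h \<in> level ((l + 1) * (n - i))}"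

context
  fixes l s :: nat and S
  assumes l_less: "l < a" and l_pos: "1 \<le> l"
  defines s_def: "s \<equiv> (a + 1) * l" and S_def: "S \<equiv> {h \<in> H. s \<le> h}"
begin

lemma s_mem_H: "s \<in> H"
  using H_I[of l l] by (simp add: s_def algebra_simps)

lemma s_positive: "0 < s"
  using l_pos by (simp add: s_def)

text \<open>Elements of H with quotient u \<le> l satisfy a u + v \<le> a l + l = s, so those beyond
  s have quotient at least l + 1. Conversely \<open>l < a\<close> gives s < a (l + 1).\<close>

lemma S_cases: "S = insert s (level (l + 1))"
proof (intro subset_antisym subsetI)
  fix x assume x: "x \<in> S"
  then obtain u v where uv: "x = a * u + v" "v \<le> u" "v < a"
    by (auto simp: S_def elim: H_reduced)
  show "x \<in> insert s (level (l + 1))"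
  proof (cases "l + 1 \<le> u")
    case True
    then have "a * (l + 1) \<le> a * u" by (rule mult_left_mono) simp
    then have "a * (l + 1) \<le> x" using uv(1) by linarith
    then show ?thesis using x by (simp add: level_def S_def)
  next
    case False
    then have "a * u \<le> a * l" by (intro mult_left_mono) auto
    then have "a * u + v \<le> a * l + l" using uv(2) False by linarith
    then have "x \<le> s" using uv(1) by (simp add: s_def algebra_simps)
    then show ?thesis using x by (simp add: S_def)
  qed
next
  fix x assume "x \<in> insert s (level (l + 1))"
  then show "x \<in> S" using s_mem_H l_less by (auto simp: S_def level_def s_def algebra_simps)
qed

lemma level_subset_mixed_level: "level ((l + 1) * n) \<subseteq> mixed_level l n"
proof
  fix h assume "h \<in> level ((l + 1) * n)"
  then have "h = 0 * s + h" "0 \<le> n" "h \<in> level ((l + 1) * (n - 0))" by simp_all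
  then show "h \<in> mixed_level l n" unfolding mixed_level_def s_def by blast
qed

text \<open>In an n-fold sum from \<open>insert s (level (l + 1))\<close>, \<open>i\<close> counts
  the summands equal to s, and \<open>level_add\<close> merges the remaining
  \<open>n - i\<close>.\<close>

lemma nfold_S: "nfold_sumset H S n = mixed_level l n"
proof (induction n)
  case 0
  show ?case by (auto simp: mixed_level_def)
next
  case (Suc n)
  have "sumset (mixed_level l n) S = mixed_level l (Suc n)"
  proof (intro subset_antisym subsetI)
    fix x assume "x \<in> sumset (mixed_level l n) S"
    then obtain i h z where x: "x = i * s + h + z" "i \<le> n" "h \<in> level ((l + 1) * (n - i))" "z \<in> S"
      by (auto simp: mixed_level_def s_def elim!: sumsetE)
    from x(4) consider "z = s" | "z \<in> level (l + 1)" unfolding S_cases by blast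
    then show "x \<in> mixed_level l (Suc n)"
    proof cases
      case 1
      then have "x = Suc i * s + h" "Suc i \<le> Suc n" "h \<in> level ((l + 1) * (Suc n - Suc i))" using x by simp_all
      then show ?thesis unfolding mixed_level_def s_def by blast
    next
      case 2
      then have "h + z \<in> level ((l + 1) * (n - i) + (l + 1))" using x(3)
        unfolding level_add[symmetric] by (intro sumsetI)
      moreover have "(l + 1) * (n - i) + (l + 1) = (l + 1) * (Suc n - i)" using x(2) by (simp add: Suc_diff_le)
      ultimately have "x = i * s + (h + z)" "i \<le> Suc n" "h + z \<in> level ((l + 1) * (Suc n - i))"
        using x by (simp_all del: mult_Suc)
      then show ?thesis unfolding mixed_level_def s_def by blast
    qed
  next
    fix x assume "x \<in> mixed_level l (Suc n)"
    then obtain i h where x: "x = i * s + h" "i \<le> Suc n" "h \<in> level ((l + 1) * (Suc n - i))"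
      by (auto simp: mixed_level_def s_def)
    show "x \<in> sumset (mixed_level l n) S"
    proof (cases i)
      \<comment> \<open>With no s to split off, one summand from \<open>level (l + 1)\<close> is
        split off instead.\<close>
      case 0
      then have "h \<in> sumset (level ((l + 1) * n)) (level (l + 1))"
        using x(3) unfolding level_add by (simp add: algebra_simps)
      then obtain y z where "h = y + z" "y \<in> level ((l + 1) * n)" "z \<in> level (l + 1)" by (elim sumsetE)
      moreover from this(2) have "y \<in> mixed_level l n"
        using level_subset_mixed_level by blast
      ultimately show ?thesis using 0 x(1) by (auto simp: S_cases)
    next
      case (Suc j)
      then have "j \<le> n" "h \<in> level ((l + 1) * (n - j))" using x by simp_all
      then have "j * s + h \<in> mixed_level l n" unfolding mixed_level_def s_def by blast
      moreover have "x = (j * s + h) + s" using Suc x(1) by simp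
      ultimately show ?thesis using S_cases by blast
    qed
  qed
  then show ?case using Suc by simp
qed

lemma mixed_level_subset_H: "mixed_level l n \<subseteq> H"
  using absorbing_nfold[OF absorbing_ge, of s n] unfolding nfold_S[unfolded S_def] by (simp add: absorbing_def)

text \<open>If a copy of s is present, it is removed. Otherwise h + s \<ge> a (l + 1) (n + 1), and s
  < a (l + 1) leaves h \<ge> a (l + 1) n.\<close>

lemma mixed_level_cancel:
  assumes "h \<in> H" "h + s \<in> mixed_level l (Suc n)"
  shows "h \<in> mixed_level l n"
proof -
  from assms(2) obtain i h' where x: "h + s = i * s + h'" "i \<le> Suc n" "h' \<in> level ((l + 1) * (Suc n - i))"
    by (auto simp: mixed_level_def s_def)
  show ?thesis
  proof (cases i)
    case 0
    then have "a * ((l + 1) * Suc n) \<le> h + s" using x by (simp add: level_def)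
    then have "a * ((l + 1) * n) \<le> h" using l_less by (simp add: s_def algebra_simps)
    then have "h \<in> level ((l + 1) * n)" using assms(1) by (simp add: level_def)
    then show ?thesis using level_subset_mixed_level by blast
  next
    case (Suc j)
    then have "h = j * s + h'" "j \<le> n" "h' \<in> level ((l + 1) * (n - j))" using x by simp_all
    then show ?thesis unfolding mixed_level_def s_def by blast
  qed
qed

lemma cohen_macaulay_assoc_graded_mixed: "cohen_macaulay_ring (assoc_graded A (supported S))"
  unfolding S_def
  by (rule cohen_macaulay_assoc_graded_ge[OF s_mem_H s_positive])
    (use mixed_level_cancel nfold_S[unfolded S_def] in metis)

text \<open>The equation I^(n+1) = Q I^n in terms of exponents. It can fail only through exponents x
  with x - s outside H, and these disappear once m^((l+1)(n+1)) starts late enough.\<close>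

lemma mixed_level_Suc_eq_translate_iff:
  "mixed_level l (Suc n) = sumset (sumset {s} H) (mixed_level l n) \<longleftrightarrow> a - 1 \<le> (l + 1) * n"
proof -
  have abs: "absorbing (mixed_level l n)" for n
    using absorbing_nfold[OF absorbing_ge, of s n] unfolding nfold_S[unfolded S_def] .
  have "s \<in> S" using s_mem_H by (simp add: S_def)
  have translate: "sumset (sumset {s} H) (mixed_level l n) = (+) s ` mixed_level l n"
  proof -
    have "sumset (sumset {s} H) (mixed_level l n) = (+) s ` sumset H (mixed_level l n)"
      by (rule sumset_translate)
    then show ?thesis using sumset_H[OF abs] by simp
  qed
  have sub: "(+) s ` mixed_level l n \<subseteq> mixed_level l (Suc n)"
    using \<open>s \<in> S\<close> by (auto simp: add.commute simp flip: nfold_S)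
  show ?thesis unfolding translate
  proof
    assume eq: "mixed_level l (Suc n) = (+) s ` mixed_level l n"
    \<comment> \<open>The critical exponent: its quotient is the least one in
      \<open>level ((l + 1) * Suc n)\<close>, and x - s = a (l + 1) n + (a - 1) has the largest
      possible remainder, so membership in H forces the bound on n.\<close>
    define x where "x = a * ((l + 1) * Suc n) + (l - 1)"
    have "x \<in> H" unfolding x_def by (rule H_I) simp
    then have "x \<in> level ((l + 1) * Suc n)" by (simp add: x_def level_def)
    then have "x \<in> mixed_level l (Suc n)" using level_subset_mixed_level by blast
    then obtain y where y: "x = s + y" "y \<in> mixed_level l n" using eq by auto
    have "y = a * ((l + 1) * n) + (a - 1)"
    proof -
      obtain b where "a = Suc b" using a_ge_2 by (cases a) auto
      moreover obtain j where "l = Suc j" using l_pos by (cases l) auto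
      ultimately show ?thesis using y(1) by (simp add: x_def s_def algebra_simps)
    qed
    moreover have "y \<in> H" using y(2) mixed_level_subset_H by blast
    ultimately have "a * ((l + 1) * n) + (a - 1) \<in> H" by simp
    then show "a - 1 \<le> (l + 1) * n" by (rule iffD1[OF H_reduced_iff, rotated]) (use a_ge_2 in simp)
  next
    assume n: "a - 1 \<le> (l + 1) * n"
    have "x \<in> (+) s ` mixed_level l n" if x: "x \<in> mixed_level l (Suc n)" for x
    proof -
      obtain i h where ih: "x = i * s + h" "i \<le> Suc n" "h \<in> level ((l + 1) * (Suc n - i))"
        using x by (auto simp: mixed_level_def s_def)
      have "s \<le> x \<and> x - s \<in> mixed_level l n"
      proof (cases i)
        case 0
        \<comment> \<open>Here x is at least a (l + 1) n + s + (a - l), so the assumption on n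
          places x - s beyond the conductor.\<close>
        have "a * (a - 1) \<le> a * ((l + 1) * n)" using n by (rule mult_left_mono) simp
        moreover have "a * ((l + 1) * Suc n) \<le> x" using ih 0 by (simp add: level_def)
        moreover have "a * ((l + 1) * Suc n) = a * ((l + 1) * n) + a * l + a" "s = a * l + l"
          by (simp_all add: s_def algebra_simps)
        ultimately have "a * (a - 1) + s \<le> x" using l_less by linarith
        then have "s \<le> x" "x - s \<in> H" using conductor[of "x - s"] by simp_all
        then show ?thesis using mixed_level_cancel[of "x - s" n] x by simp
      next
        case (Suc j)
        then have "x - s = j * s + h" "j \<le> n" "h \<in> level ((l + 1) * (n - j))" "s \<le> x" using ih by simp_all
        then show ?thesis unfolding mixed_level_def s_def by blast
      qed
      then show ?thesis by (intro image_eqI[of _ _ "x - s"]) auto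
    qed
    then show "mixed_level l (Suc n) = (+) s ` mixed_level l n" using sub by blast
  qed
qed

text \<open>The defining equation holds exactly for n \<ge> (a - 1) / (l + 1), so the infimum is
  attained at the ceiling.\<close>

lemma reduction_number_eq:
  "reduction_number A (Idl\<^bsub>A\<^esub> {fps_X ^ s}) (supported S) = enat (nat \<lceil>(real a - 1) / (real l + 1)\<rceil>)"
proof -
  let ?r = "nat \<lceil>(real a - 1) / (real l + 1)\<rceil>"
  have absS: "absorbing S" unfolding S_def by (rule absorbing_ge)
  have pow: "ideal_pow A (supported S) n = supported (mixed_level l n)" for n
    by (simp only: ideal_pow_supported[OF absS] nfold_S)
  have "ideal_pow A (supported S) (Suc n) = (Idl\<^bsub>A\<^esub> {fps_X ^ s}) \<cdot>\<^bsub>A\<^esub> ideal_pow A (supported S) n \<longleftrightarrow> ?r \<le> n" for n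
  proof -
    have "absorbing (mixed_level l n)" using absorbing_nfold[OF absS, of n] by (simp only: nfold_S)
    then have "ideal_pow A (supported S) (Suc n) = (Idl\<^bsub>A\<^esub> {fps_X ^ s}) \<cdot>\<^bsub>A\<^esub> ideal_pow A (supported S) n \<longleftrightarrow>
        a - 1 \<le> (l + 1) * n"
      unfolding pow genideal_fps_X_power[OF s_mem_H]
      by (simp only: ideal_prod_supported[OF absorbing_translate[OF s_mem_H]] supported_inject
          mixed_level_Suc_eq_translate_iff)
    also have "\<dots> \<longleftrightarrow> real (a - 1) \<le> real ((l + 1) * n)" by (simp only: of_nat_le_iff)
    also have "\<dots> \<longleftrightarrow> (real a - 1) / (real l + 1) \<le> real n"
      using a_ge_2 by (simp add: of_nat_diff pos_divide_le_eq algebra_simps)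
    also have "\<dots> \<longleftrightarrow> ?r \<le> n" by (simp only: nat_ceiling_le_eq)
    finally show ?thesis .
  qed
  then have "reduction_number A (Idl\<^bsub>A\<^esub> {fps_X ^ s}) (supported S) = Inf {enat n | n. ?r \<le> n}"
    unfolding reduction_number_def by presburger
  also have "\<dots> = enat ?r"
    by (rule Inf_enat_ge)
  finally show ?thesis .
qed

end

end

theorem corollary3p6:
  fixes a q s l r :: nat
    and H :: "nat set"
    and A :: "'k::field fps ring"
    and m Q I :: "'k fps set"
  assumes "a \<ge> 2"
    and "H = semigroup_gen2 a (a + 1)"
    and "A = semigroup_ring H"
    and "m = Idl\<^bsub>A\<^esub> {fps_X ^ a, fps_X ^ (a + 1)}"
    and "q = a - 1"
    and "s \<in> H" and "0 < s" and "s < a * q"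
    and "Q = Idl\<^bsub>A\<^esub> {fps_X ^ s}"
    and "I = ideal_colon A Q (ideal_pow A m q)"
    and "s = a * l + r" and "1 \<le> l" and "l < q" and "r < a"
  shows "(r = 0 \<longrightarrow>
            I = ideal_pow A m l \<and> cohen_macaulay_ring (assoc_graded A I)) \<and>
         (r = l \<longrightarrow>
            cohen_macaulay_ring (assoc_graded A I) \<and>
            reduction_number A Q I = enat (nat \<lceil>(real a - 1) / (real l + 1)\<rceil>))"
proof -
  interpret consecutive_semigroup_algebra a H A
    by unfold_locales (use assms in auto)
  have pow: "ideal_pow A m n = supported (level n)" for n
    unfolding \<open>m = _\<close> by (rule maximal_ideal_pow)
  have I: "I = supported {h \<in> H. s \<le> h}"
    unfolding \<open>I = _\<close> pow \<open>Q = _\<close> \<open>q = _\<close> using assms(6,7) by (rule colon_eq)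
  show ?thesis
  proof (intro conjI impI)
    assume "r = 0"
    then have "I = supported (level l)" unfolding I by (simp add: level_def assms(11))
    then show "I = ideal_pow A m l" "cohen_macaulay_ring (assoc_graded A I)"
      using cohen_macaulay_assoc_graded_level[OF assms(12)] by (simp_all add: pow)
  next
    assume "r = l"
    then have s: "s = (a + 1) * l" by (simp add: assms(11))
    have l: "l < a" using assms(5,13) by simp
    show "cohen_macaulay_ring (assoc_graded A I)"
      unfolding I s using l assms(12) by (rule cohen_macaulay_assoc_graded_mixed)
    show "reduction_number A Q I = enat (nat \<lceil>(real a - 1) / (real l + 1)\<rceil>)"
      unfolding I \<open>Q = _\<close> s using l assms(12) by (rule reduction_number_eq)
  qed
qed

end
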